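(* Let $\mathrm{x}=(x,X)$ and $\mathrm{y}=(y,Y)$ be elements of the unit tangent bundle of $\mathbb R^2$. If $\gamma$ is a length minimising path in $\Gamma(\mathrm{x},\mathrm{y})$, that is, $\gamma\in\Gamma(\mathrm{x},\mathrm{y})$ and $\mathcal L(\gamma)\le \mathcal L(\beta)$ for every $\beta\in\Gamma(\mathrm{x},\mathrm{y})$, then $\gamma$ is either a CCC path having its middle component of length greater than $\pi$, or a CSC path. Here some of the circular arcs or line segments can have zero length.
   Context: The curvature bound is normalised to $\kappa=1$. For $\mathrm{x}=(x,X)$, $\mathrm{y}=(y,Y)$ with $x,y\in\mathbb R^2$ and $X,Y$ unit vectors (tangent vectors at $x$ and $y$), a bounded curvature path from $\mathrm{x}$ to $\mathrm{y}$ is a path $\gamma:[0,s]\to\mathbb R^2$ that is $C^1$ and piecewise $C^2$, is parametrised by arc length ($\|\gamma'(t)\|=1$ for all $t$), satisfies $\gamma(0)=x$, $\gamma'(0)=X$, $\gamma(s)=y$, $\gamma'(s)=Y$, and satisfies $\|\gamma''(t)\|\le 1$ wherever $\gamma''(t)$ is defined. $\Gamma(\mathrm{x},\mathrm{y})$ denotes the set of all such paths (with $s$ allowed to vary), and $\mathcal L(\gamma)=s$ is the length of $\gamma$. A $cs$ path is a bounded curvature path that is a finite concatenation of line segments (denoted S) and arcs of unit circles (denoted C); these pieces are its components. An arc C is of type R if traversed clockwise and of type L if traversed counterclockwise. Words in C and S describe the successive components; two consecutive C components have opposite orientations. Thus a CSC path is an arc of a unit circle followed by a line segment followed by an arc of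 a unit circle (types LSL, LSR, RSL, RSR), and a CCC path is of type LRL or RLR. *)

theory Defs
  imports "HOL-Analysis.Analysis"
begin

type_synonym plane = "real ^ 2"

text \<open>A pair \<open>(g, s)\<close> stands for the path \<open>g : [0, s] \<rightarrow> R\<^sup>2\<close>; values of \<open>g\<close> outside
  \<open>{0..s}\<close> are irrelevant, so all derivatives below are taken within \<open>{0..s}\<close>
  (hence one-sided at the two ends).\<close>

type_synonym plane_path = "(real \<Rightarrow> plane) \<times> real"

definition unit_tangent_bundle :: "(plane \<times> plane) set" where
  "unit_tangent_bundle = {(p, V). norm V = 1}"

definition velocity :: "plane_path \<Rightarrow> real \<Rightarrow> plane" where
  "velocity \<gamma> t = vector_derivative (fst \<gamma>) (at t within {0..snd \<gamma>})"

definition C1_path :: "plane_path \<Rightarrow> bool" where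
  "C1_path \<gamma> \<longleftrightarrow>
     (\<forall>t\<in>{0..snd \<gamma>}. fst \<gamma> differentiable (at t within {0..snd \<gamma>})) \<and>
     continuous_on {0..snd \<gamma>} (velocity \<gamma>)"

definition C2_on_interval :: "(real \<Rightarrow> plane) \<Rightarrow> real \<Rightarrow> real \<Rightarrow> bool" where
  "C2_on_interval g a b \<longleftrightarrow>
     (\<exists>g1 g2. (\<forall>t\<in>{a..b}. (g has_vector_derivative g1 t) (at t within {a..b})) \<and>
              (\<forall>t\<in>{a..b}. (g1 has_vector_derivative g2 t) (at t within {a..b})) \<and>
              continuous_on {a..b} g2)"

definition piecewise_C2_path :: "plane_path \<Rightarrow> bool" where
  "piecewise_C2_path \<gamma> \<longleftrightarrow>
     (\<exists>(n::nat) (p :: nat \<Rightarrow> real). p 0 = 0 \<and> p n = snd \<gamma> \<and>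
        (\<forall>i<n. p i < p (Suc i) \<and> C2_on_interval (fst \<gamma>) (p i) (p (Suc i))))"

text \<open>The set \<open>\<Gamma>(x, y)\<close>. The interval is required to be nondegenerate, since otherwise
  \<open>\<gamma>'(0)\<close> and \<open>\<gamma>'(s)\<close> make no sense.\<close>

definition bounded_curvature_paths ::
  "plane \<times> plane \<Rightarrow> plane \<times> plane \<Rightarrow> plane_path set" where
  "bounded_curvature_paths x y = {\<gamma>.
     0 < snd \<gamma> \<and>
     C1_path \<gamma> \<and> piecewise_C2_path \<gamma> \<and>
     (\<forall>t\<in>{0..snd \<gamma>}. norm (velocity \<gamma> t) = 1) \<and>
     fst \<gamma> 0 = fst x \<and> velocity \<gamma> 0 = snd x \<and>
     fst \<gamma> (snd \<gamma>) = fst y \<and> velocity \<gamma> (snd \<gamma>) = snd y \<and>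
     (\<forall>t\<in>{0..snd \<gamma>}. \<forall>A. (velocity \<gamma> has_vector_derivative A) (at t within {0..snd \<gamma>})
        \<longrightarrow> norm A \<le> 1)}"

definition path_len :: "plane_path \<Rightarrow> real" where
  "path_len \<gamma> = snd \<gamma>"

text \<open>\<open>Lt\<close> and \<open>Rt\<close> are the counterclockwise and the clockwise unit circular arcs,
  \<open>St\<close> the line segments.\<close>

datatype component = Lt | Rt | St

definition circle_point :: "plane \<Rightarrow> real \<Rightarrow> plane" where
  "circle_point c \<theta> = c + vector [cos \<theta>, sin \<theta>]"

text \<open>\<open>traverses g k a b\<close>: on \<open>{a..b}\<close> the path \<open>g\<close> runs at unit speed along a component
  of type \<open>k\<close>. Its length is \<open>b - a\<close>, possibly zero; an arc goes around its circle at most once.\<close>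

fun traverses :: "(real \<Rightarrow> plane) \<Rightarrow> component \<Rightarrow> real \<Rightarrow> real \<Rightarrow> bool" where
  "traverses g St a b \<longleftrightarrow> a \<le> b \<and>
     (\<exists>p v. norm v = 1 \<and> (\<forall>t\<in>{a..b}. g t = p + (t - a) *\<^sub>R v))"
| "traverses g Lt a b \<longleftrightarrow> a \<le> b \<and> b - a \<le> 2 * pi \<and>
     (\<exists>c \<theta>. \<forall>t\<in>{a..b}. g t = circle_point c (\<theta> + (t - a)))"
| "traverses g Rt a b \<longleftrightarrow> a \<le> b \<and> b - a \<le> 2 * pi \<and>
     (\<exists>c \<theta>. \<forall>t\<in>{a..b}. g t = circle_point c (\<theta> - (t - a)))"

text \<open>\<open>cs_path x y \<gamma> w T\<close>: \<open>\<gamma>\<close> is a cs path from \<open>x\<close> to \<open>y\<close> whose successive components have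
  the types listed in \<open>w\<close>, the \<open>i\<close>-th one (counted from 0) being traversed on
  \<open>{T ! i..T ! Suc i}\<close>.\<close>

definition cs_path ::
  "plane \<times> plane \<Rightarrow> plane \<times> plane \<Rightarrow> plane_path \<Rightarrow> component list \<Rightarrow> real list \<Rightarrow> bool" where
  "cs_path x y \<gamma> w T \<longleftrightarrow>
     \<gamma> \<in> bounded_curvature_paths x y \<and>
     length T = Suc (length w) \<and> T ! 0 = 0 \<and> T ! length w = snd \<gamma> \<and>
     (\<forall>i<length w. traverses (fst \<gamma>) (w ! i) (T ! i) (T ! Suc i)) \<and>
     (\<forall>i. Suc i < length w \<and> w ! i \<noteq> St \<and> w ! Suc i \<noteq> St \<longrightarrow> w ! i \<noteq> w ! Suc i)"

definition component_length :: "real list \<Rightarrow> nat \<Rightarrow> real" where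
  "component_length T i = T ! Suc i - T ! i"

definition CSC_words :: "component list set" where
  "CSC_words = {[Lt, St, Lt], [Lt, St, Rt], [Rt, St, Lt], [Rt, St, Rt]}"

definition CCC_words :: "component list set" where
  "CCC_words = {[Lt, Rt, Lt], [Rt, Lt, Rt]}"

end

theory Submission
  imports Defs
begin

text \<open>A path of unit speed is determined, up to translation, by its direction \<open>v\<close>, a curve on the
  unit circle; the curvature bound says that \<open>v\<close> is \<open>1\<close>-Lipschitz, and the end condition
  fixes the two end directions and the displacement \<open>\<integral>v\<close>. Directions are complex numbers here, and
  the proof takes place among functions \<open>v\<close>. A piece of a shortest path is shortest
  between its own end data, so any explicit concatenation of arcs and segments (a \<^emph>\<open>program\<close>) with the
  end directions and displacement of a piece of \<open>v\<close> is at least as long as that piece.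

  The first step shows that a shortest \<open>v\<close> is locally of type CSC (\<open>local_structure\<close>). Over a
  time at most \<open>1\<close> write \<open>v = cis \<theta>\<close> with \<open>\<theta>\<close> \<open>1\<close>-Lipschitz. Consider the programs that turn
  directly to a direction \<open>\<psi>\<close>, go straight, and turn directly to the final direction. The
  intermediate value theorem gives a value \<open>\<psi>\<close> of \<open>\<theta>\<close> for which such a program has the right
  displacement perpendicular to \<open>\<psi>\<close>, and the segment can be chosen, of nonnegative length,
  to adjust the displacement along \<open>\<psi>\<close>. Since \<open>\<theta>\<close> cannot approach \<open>\<psi>\<close> faster than a
  direct turn, the displacement along \<open>\<psi>\<close> is at most that of the direct turns with a segment
  filling the remaining time. Hence the program is no longer than the piece of \<open>v\<close>, and equality of
  the lengths forces \<open>v\<close> to be the program.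

  Consequently \<open>v\<close> splits into maximal pieces, each a segment or an arc. The second step
  rules out the other sequences of pieces by explicit shorter programs: SCS and SCC
  (\<open>shortenable_SLS\<close>, \<open>shortenable_SLR\<close>) by moving the initial segment sideways, which costs length of
  second order only and makes room for a gain of first order; CCC with a middle arc of length
  at most \<open>\<pi>\<close> (\<open>shortenable_RLR\<close>) by cutting the middle arc with a segment; and CCCC with both middle
  arcs longer than \<open>\<pi>\<close> (\<open>shortenable_RLRL\<close>) by moving the two middle circles. Reflection and reversal
  yield the remaining cases. Reading the pieces from the start, at most three can occur, and they
  form a CSC path or a CCC path whose middle arc is longer than \<open>\<pi>\<close>; an arc longer than a full circle,
  or a full circle followed by anything, is excluded because a full circle can be deleted.\<close>

section \<open>Direction functions\<close>

definition C1_on :: "(real \<Rightarrow> complex) \<Rightarrow> real \<Rightarrow> real \<Rightarrow> bool" where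
  "C1_on v a b \<longleftrightarrow>
     (\<exists>v'. (\<forall>t\<in>{a..b}. (v has_vector_derivative v' t) (at t within {a..b})) \<and>
           continuous_on {a..b} v')"

text \<open>The inductive form makes concatenation, restriction and translation plain inductions; the
  piecewise continuously differentiable direction functions are those of piecewise \<open>C\<^sup>2\<close> paths.\<close>

inductive pw_C1 :: "(real \<Rightarrow> complex) \<Rightarrow> real \<Rightarrow> real \<Rightarrow> bool" for v where
  refl: "pw_C1 v a a"
| step: "a < b \<Longrightarrow> C1_on v a b \<Longrightarrow> pw_C1 v b c \<Longrightarrow> pw_C1 v a c"

text \<open>The directions of bounded curvature paths. A Lipschitz condition in place of a bound on the
  derivative is meaningful at break points as well, so it passes to concatenations.\<close>

definition steering :: "(real \<Rightarrow> complex) \<Rightarrow> real \<Rightarrow> real \<Rightarrow> bool" where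
  "steering v a b \<longleftrightarrow>
     a \<le> b \<and> (\<forall>t\<in>{a..b}. norm (v t) = 1) \<and> 1-lipschitz_on {a..b} v \<and> pw_C1 v a b"

lemma C1_on_subinterval:
  assumes "C1_on v a b" "a \<le> a'" "b' \<le> b"
  shows "C1_on v a' b'"
proof -
  obtain v' where v': "\<forall>t\<in>{a..b}. (v has_vector_derivative v' t) (at t within {a..b})"
    "continuous_on {a..b} v'"
    using assms(1) unfolding C1_on_def by blast
  have sub: "{a'..b'} \<subseteq> {a..b}" using assms by auto
  show ?thesis unfolding C1_on_def
    using v' sub by (meson continuous_on_subset has_vector_derivative_within_subset subsetD)
qed

lemma C1_on_cong:
  assumes "C1_on v a b" "\<And>t. t \<in> {a..b} \<Longrightarrow> w t = v t"
  shows "C1_on w a b"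
proof -
  obtain v' where v': "\<forall>t\<in>{a..b}. (v has_vector_derivative v' t) (at t within {a..b})"
    "continuous_on {a..b} v'"
    using assms(1) unfolding C1_on_def by blast
  have "\<forall>t\<in>{a..b}. (w has_vector_derivative v' t) (at t within {a..b})"
    using v'(1) assms(2) has_vector_derivative_transform by blast
  then show ?thesis using v'(2) unfolding C1_on_def by blast
qed

lemma C1_on_shift:
  assumes "C1_on v a b"
  shows "C1_on (\<lambda>t. v (t + c)) (a - c) (b - c)"
proof -
  obtain v' where v': "\<forall>t\<in>{a..b}. (v has_vector_derivative v' t) (at t within {a..b})"
    "continuous_on {a..b} v'"
    using assms(1) unfolding C1_on_def by blast
  have im: "(\<lambda>t. t + c) ` {a - c..b - c} = {a..b}" by (simp add: add.commute[of _ c])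
  have "((v \<circ> (\<lambda>t. t + c)) has_vector_derivative (1 *\<^sub>R v' (t + c))) (at t within {a - c..b - c})"
    if "t \<in> {a - c..b - c}" for t
    using that v'(1) im
    by (intro vector_diff_chain_within) (auto intro!: derivative_eq_intros)
  moreover have "continuous_on {a - c..b - c} (v' \<circ> (\<lambda>t. t + c))"
    using v'(2) im by (intro continuous_on_compose) (auto intro!: continuous_intros)
  ultimately show ?thesis unfolding C1_on_def comp_def
    by (intro exI[of _ "\<lambda>t. v' (t + c)"]) auto
qed

lemma pw_C1_single: "C1_on v a b \<Longrightarrow> a \<le> b \<Longrightarrow> pw_C1 v a b"
  by (cases "a = b") (auto intro: pw_C1.refl pw_C1.step[OF _ _ pw_C1.refl])

lemma pw_C1_le: "pw_C1 v a b \<Longrightarrow> a \<le> b"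
  by (induction rule: pw_C1.induct) auto

lemma pw_C1_trans: "pw_C1 v a b \<Longrightarrow> pw_C1 v b c \<Longrightarrow> pw_C1 v a c"
  by (induction rule: pw_C1.induct) (auto intro: pw_C1.step)

lemma pw_C1_tail: "pw_C1 v a c \<Longrightarrow> a \<le> b \<Longrightarrow> b \<le> c \<Longrightarrow> pw_C1 v b c"
proof (induction arbitrary: b rule: pw_C1.induct)
  case (refl a) then show ?case by (auto intro: pw_C1.refl)
next
  case (step a b' c)
  show ?case
  proof (cases "b < b'")
    case True
    then show ?thesis using step by (intro pw_C1.step[OF True]) (auto intro: C1_on_subinterval)
  next
    case False
    then show ?thesis using step by auto
  qed
qed

lemma pw_C1_init: "pw_C1 v a c \<Longrightarrow> a \<le> b \<Longrightarrow> b \<le> c \<Longrightarrow> pw_C1 v a b"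
proof (induction arbitrary: b rule: pw_C1.induct)
  case (refl a) then show ?case by (auto intro: pw_C1.refl)
next
  case (step a b' c)
  show ?case
  proof (cases "b' \<le> b")
    case True
    then show ?thesis using step by (intro pw_C1.step[OF step(1)]) auto
  next
    case False
    then have "C1_on v a b" using step by (auto intro: C1_on_subinterval)
    then show ?thesis using step.prems by (auto intro: pw_C1_single)
  qed
qed

lemma pw_C1_cong:
  "pw_C1 v a b \<Longrightarrow> (\<And>t. t \<in> {a..b} \<Longrightarrow> w t = v t) \<Longrightarrow> pw_C1 w a b"
proof (induction rule: pw_C1.induct)
  case (refl a) then show ?case by (auto intro: pw_C1.refl)
next
  case (step a b c)
  have "b \<le> c" using step pw_C1_le by blast
  then show ?case using step by (intro pw_C1.step[OF step(1)]) (auto intro: C1_on_cong)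
qed

lemma pw_C1_shift:
  "pw_C1 v a b \<Longrightarrow> pw_C1 (\<lambda>t. v (t + c)) (a - c) (b - c)"
proof (induction rule: pw_C1.induct)
  case (step a b d)
  then show ?case by (intro pw_C1.step[of "a - c" "b - c"]) (auto intro: C1_on_shift)
qed (rule pw_C1.refl)

lemma steering_subinterval:
  "steering v a b \<Longrightarrow> a \<le> a' \<Longrightarrow> a' \<le> b' \<Longrightarrow> b' \<le> b \<Longrightarrow> steering v a' b'"
  unfolding steering_def
  by (auto intro: lipschitz_on_subset pw_C1_tail[OF pw_C1_init])

lemma steering_cong:
  assumes "steering v a b" "\<And>t. t \<in> {a..b} \<Longrightarrow> w t = v t"
  shows "steering w a b"
  using assms unfolding steering_def
  by (auto intro: pw_C1_cong simp: lipschitz_on_def)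

lemma steering_shift:
  assumes "steering v a b"
  shows "steering (\<lambda>t. v (t + c)) (a - c) (b - c)"
proof -
  have "1-lipschitz_on {a - c..b - c} (\<lambda>t. v (t + c))"
  proof (rule lipschitz_onI)
    fix x y assume "x \<in> {a - c..b - c}" "y \<in> {a - c..b - c}"
    then have "dist (v (x + c)) (v (y + c)) \<le> 1 * dist (x + c) (y + c)"
      using assms unfolding steering_def by (intro lipschitz_onD[of 1 "{a..b}"]) auto
    then show "dist (v (x + c)) (v (y + c)) \<le> 1 * dist x y" by (simp add: dist_norm)
  qed simp
  then show ?thesis using assms unfolding steering_def by (auto intro: pw_C1_shift)
qed

lemma steering_join:
  assumes "steering v a b" "steering v b c"
  shows "steering v a c"
proof -
  have "1-lipschitz_on {a..c} (\<lambda>t. if t \<le> b then v t else v t)"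
    using assms unfolding steering_def by (intro lipschitz_on_concat) auto
  moreover have "\<forall>t\<in>{a..c}. norm (v t) = 1"
    using assms unfolding steering_def by (metis atLeastAtMost_iff le_cases)
  ultimately show ?thesis using assms unfolding steering_def
    by (auto intro: pw_C1_trans)
qed

lemma steering_continuous: "steering v a b \<Longrightarrow> continuous_on {a..b} v"
  unfolding steering_def using lipschitz_on_continuous_on by blast

lemma steering_integrable: "steering v a b \<Longrightarrow> v integrable_on {a..b}"
  by (simp add: steering_continuous integrable_continuous_interval)

lemma integral_shift_interval:
  fixes v :: "real \<Rightarrow> complex"
  assumes "continuous_on {a..b} v"
  shows "integral {a - c..b - c} (\<lambda>t. v (t + c)) = integral {a..b} v"
  using integral_shift[of "a - c" c "b - c" v] assms by (simp add: comp_def)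

definition realises :: "complex \<Rightarrow> complex \<Rightarrow> complex \<Rightarrow> real \<Rightarrow> (real \<Rightarrow> complex) \<Rightarrow> bool" where
  "realises X Y d T v \<longleftrightarrow> steering v 0 T \<and> v 0 = X \<and> v T = Y \<and> integral {0..T} v = d"

lemma realises_join:
  assumes "realises X Y d T v" "realises Y Z e U w"
  shows "realises X Z (d + e) (T + U) (\<lambda>t. if t \<le> T then v t else w (t - T))"
proof -
  let ?f = "\<lambda>t. if t \<le> T then v t else w (t - T)"
  have T: "0 \<le> T" "0 \<le> U" using assms unfolding realises_def steering_def by auto
  have 1: "steering ?f 0 T"
    using assms(1) unfolding realises_def by (auto intro: steering_cong)
  have w': "steering (\<lambda>t. w (t - T)) T (T + U)"
    using assms(2) steering_shift[of w 0 U "- T"] unfolding realises_def by (simp add: add.commute)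
  have eq2: "?f t = w (t - T)" if "t \<in> {T..T+U}" for t
    using that assms unfolding realises_def by (cases "t = T") auto
  have 2: "steering ?f T (T + U)"
    using w' eq2 by (rule steering_cong)
  have s: "steering ?f 0 (T + U)" using 1 2 by (rule steering_join)
  have "integral {0..T + U} ?f = integral {0..T} ?f + integral {T..T + U} ?f"
    using T s by (intro Henstock_Kurzweil_Integration.integral_combine[symmetric] steering_integrable) auto
  also have "integral {0..T} ?f = d"
    using assms(1) unfolding realises_def by (auto intro: integral_cong)
  also have "integral {T..T + U} ?f = integral {T..T + U} (\<lambda>t. w (t - T))"
    by (intro integral_cong) (use eq2 in auto)
  also have "\<dots> = e"
    using assms(2) integral_shift_interval[of 0 U w "- T"] steering_continuous
    unfolding realises_def by (auto simp: add.commute)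
  finally show ?thesis
    using s T assms eq2[of "T + U"] unfolding realises_def by auto
qed

lemma realises_restrict:
  assumes "steering v a b"
  shows "realises (v a) (v b) (integral {a..b} v) (b - a) (\<lambda>t. v (t + a))"
  using steering_shift[OF assms, of a] integral_shift_interval[of a b v a] steering_continuous[OF assms]
  unfolding realises_def by simp

section \<open>Programs of arcs and segments\<close>

text \<open>The displacement after time \<open>l\<close> when starting in direction \<open>1\<close> and turning at the constant rate \<open>k\<close>,
  that is, the integral of \<open>cis (k * t)\<close> over \<open>t\<close> from \<open>0\<close> to \<open>l\<close>, for \<open>k \<in> {-1, 0, 1}\<close>.\<close>

definition turn_disp :: "real \<Rightarrow> real \<Rightarrow> complex" where
  "turn_disp k l = Complex (if k = 0 then l else sin l) (k * (1 - cos l))"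

lemma turn_disp_has_vector_derivative:
  assumes "k \<in> {-1, 0, 1}"
  shows "(turn_disp k has_vector_derivative cis (k * t)) (at t within S)"
proof -
  have "((\<lambda>t. Complex (if k = 0 then t else sin t) (k * (1 - cos t))) has_vector_derivative
      Complex (if k = 0 then 1 else cos t) (k * sin t)) (at t within S)"
    by (auto simp: has_vector_derivative_complex_iff intro!: derivative_eq_intros)
  then show ?thesis
    using assms by (auto simp: turn_disp_def[abs_def] cis.ctr complex_eq_iff)
qed

lemma cis_has_vector_derivative:
  "((\<lambda>t. X * cis (k * t)) has_vector_derivative (X * (\<i> * of_real k * cis (k * t)))) (at t within S)"
  by (auto simp: has_vector_derivative_complex_iff algebra_simps intro!: derivative_eq_intros)

lemma integral_turn:
  assumes "k \<in> {-1, 0, 1}" "0 \<le> l"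
  shows "integral {0..l} (\<lambda>t. X * cis (k * t)) = X * turn_disp k l"
proof -
  have "((\<lambda>t. X * turn_disp k t) has_vector_derivative X * cis (k * t)) (at t within {0..l})" for t
    by (intro has_vector_derivative_mult_right turn_disp_has_vector_derivative assms)
  then have "((\<lambda>t. X * cis (k * t)) has_integral X * turn_disp k l - X * turn_disp k 0) {0..l}"
    by (intro fundamental_theorem_of_calculus assms(2))
  then have "integral {0..l} (\<lambda>t. X * cis (k * t)) = X * turn_disp k l - X * turn_disp k 0"
    by (rule integral_unique)
  moreover have "turn_disp k 0 = 0" by (simp add: turn_disp_def complex_eq_iff)
  ultimately show ?thesis by (simp only: mult_zero_right diff_zero)
qed

lemma steering_turn:
  assumes "norm X = 1" "k \<in> {-1, 0, 1}" "0 \<le> l"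
  shows "steering (\<lambda>t. X * cis (k * t)) 0 l"
proof -
  have C1: "C1_on (\<lambda>t. X * cis (k * t)) 0 l"
    unfolding C1_on_def
    by (intro exI[of _ "\<lambda>t. X * (\<i> * of_real k * cis (k * t))"])
       (auto intro!: cis_has_vector_derivative continuous_intros)
  have "1-lipschitz_on {0..l} (\<lambda>t. X * cis (k * t))"
  proof (rule bounded_derivative_imp_lipschitz)
    fix t :: real
    show "((\<lambda>t. X * cis (k * t)) has_derivative (\<lambda>h. h *\<^sub>R (X * (\<i> * of_real k * cis (k * t)))))
       (at t within {0..l})"
      using cis_has_vector_derivative unfolding has_vector_derivative_def by blast
    show "onorm (\<lambda>h. h *\<^sub>R (X * (\<i> * complex_of_real k * cis (k * t)))) \<le> 1"
      using assms(1,2) by (intro onorm_le) (auto simp: norm_mult)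
  qed auto
  then show ?thesis
    using pw_C1_single[OF C1] assms by (auto simp: steering_def norm_mult)
qed

text \<open>A program lists turning rates (\<open>1\<close> left, \<open>-1\<close> right, \<open>0\<close> straight) with the lengths for which they
  are kept. A finite syntax for the competitors lets end direction, displacement, reflection
  and reversal be computed by recursion.\<close>

type_synonym program = "(real \<times> real) list"

definition valid :: "program \<Rightarrow> bool" where
  "valid ps \<longleftrightarrow> (\<forall>(k, l)\<in>set ps. k \<in> {-1, 0, 1} \<and> 0 \<le> l)"

fun turn :: "program \<Rightarrow> real" where
  "turn [] = 0"
| "turn ((k, l) # ps) = k * l + turn ps"

fun len :: "program \<Rightarrow> real" where
  "len [] = 0"
| "len ((k, l) # ps) = l + len ps"

fun disp :: "program \<Rightarrow> complex" where
  "disp [] = 0"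
| "disp ((k, l) # ps) = turn_disp k l + cis (k * l) * disp ps"

lemma program_realises:
  "valid ps \<Longrightarrow> norm X = 1 \<Longrightarrow> \<exists>v. realises X (X * cis (turn ps)) (X * disp ps) (len ps) v"
proof (induction ps arbitrary: X rule: len.induct)
  case 1
  have "realises X X 0 0 (\<lambda>t. X)"
    using 1 by (auto simp: realises_def steering_def lipschitz_on_def intro: pw_C1.refl)
  then show ?case by auto
next
  case (2 k l ps)
  have kl: "k \<in> {-1, 0, 1}" "0 \<le> l" "valid ps" using 2(2) by (auto simp: valid_def)
  have "realises X (X * cis (k * l)) (X * turn_disp k l) l (\<lambda>t. X * cis (k * t))"
    using steering_turn[OF 2(3) kl(1,2)] integral_turn[OF kl(1,2), of X]
    unfolding realises_def by (simp only:) simp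
  moreover obtain w where "realises (X * cis (k * l)) (X * cis (k * l) * cis (turn ps))
      (X * cis (k * l) * disp ps) (len ps) w"
    using 2(1)[OF kl(3), of "X * cis (k * l)"] 2(3) by (auto simp: norm_mult)
  ultimately have "\<exists>v. realises X (X * cis (k * l) * cis (turn ps))
      (X * turn_disp k l + X * cis (k * l) * disp ps) (l + len ps) v"
    using realises_join by blast
  moreover have "X * cis (k * l) * cis (turn ps) = X * cis (turn ((k, l) # ps))"
    "X * turn_disp k l + X * cis (k * l) * disp ps = X * disp ((k, l) # ps)"
    "l + len ps = len ((k, l) # ps)"
    by (simp_all add: cis_mult[symmetric] algebra_simps)
  ultimately show ?case by (simp only:)
qed

text \<open>Comparing the turn only through \<open>cis\<close> lets competitors differ from \<open>ps\<close> by full rotations, as is needed to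
  delete full circles. The competitor must have positive length, like all paths.\<close>

definition shortenable :: "program \<Rightarrow> bool" where
  "shortenable ps \<longleftrightarrow>
     (\<exists>qs. valid qs \<and> 0 < len qs \<and> len qs < len ps \<and>
           cis (turn qs) = cis (turn ps) \<and> disp qs = disp ps)"

lemma len_append [simp]: "len (ps @ qs) = len ps + len qs"
  by (induction ps rule: len.induct) auto

lemma turn_append [simp]: "turn (ps @ qs) = turn ps + turn qs"
  by (induction ps rule: len.induct) auto

lemma disp_append [simp]: "disp (ps @ qs) = disp ps + cis (turn ps) * disp qs"
  by (induction ps rule: len.induct) (auto simp: algebra_simps cis_mult[symmetric])

lemma valid_append [simp]: "valid (ps @ qs) \<longleftrightarrow> valid ps \<and> valid qs"
  by (auto simp: valid_def)

lemma valid_simps [simp]: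
  "valid []"
  "valid ((k, l) # ps) \<longleftrightarrow> k \<in> {-1, 0, 1} \<and> 0 \<le> l \<and> valid ps"
  by (auto simp: valid_def)

lemma valid_len: "valid ps \<Longrightarrow> 0 \<le> len ps"
  by (induction ps rule: len.induct) auto

lemma turn_disp_left: "turn_disp 1 l = - \<i> * (cis l - 1)"
  and turn_disp_right: "turn_disp (-1) l = \<i> * (cis (- l) - 1)"
  and turn_disp_straight: "turn_disp 0 l = of_real l"
  by (auto simp: turn_disp_def complex_eq_iff)

definition mirror :: "program \<Rightarrow> program" where
  "mirror = map (\<lambda>(k, l). (- k, l))"

text \<open>Traversed backwards in time, the direction function takes the same values, so the
  displacement is unchanged while each rate changes sign and the end directions are exchanged.\<close>

definition backward :: "program \<Rightarrow> program" where
  "backward ps = rev (mirror ps)"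

lemma mirror_simps [simp]: "mirror [] = []" "mirror ((k, l) # ps) = (- k, l) # mirror ps"
  by (auto simp: mirror_def)

lemma len_mirror [simp]: "len (mirror ps) = len ps"
  and turn_mirror [simp]: "turn (mirror ps) = - turn ps"
  and disp_mirror [simp]: "disp (mirror ps) = cnj (disp ps)"
  and valid_mirror [simp]: "valid (mirror ps) = valid ps"
  by (induction ps rule: len.induct) (auto simp: turn_disp_def complex_eq_iff cis_cnj)

lemma backward_simps [simp]: "backward [] = []" "backward ((k, l) # ps) = backward ps @ [(- k, l)]"
  by (auto simp: backward_def)

lemma len_backward [simp]: "len (backward ps) = len ps"
  and turn_backward [simp]: "turn (backward ps) = - turn ps"
  and valid_backward [simp]: "valid (backward ps) = valid ps"
  by (induction ps rule: len.induct) auto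

lemma turn_disp_backward: "k \<in> {-1, 0, 1} \<Longrightarrow> cis (k * l) * turn_disp (- k) l = turn_disp k l"
  using sin_cos_squared_add[of l]
  by (auto simp: turn_disp_def complex_eq_iff algebra_simps power2_eq_square)

lemma disp_backward: "valid ps \<Longrightarrow> cis (turn ps) * disp (backward ps) = disp ps"
proof (induction ps rule: len.induct)
  case (2 k l ps)
  have "cis (turn ps) * disp (backward ps) = disp ps" using 2 by simp
  moreover have "cis (turn ps) * cis (- turn ps) = 1" by (simp add: cis_mult)
  moreover have "cis (k * l) * turn_disp (- k) l = turn_disp k l" using 2 turn_disp_backward by simp
  moreover have "cis (turn ((k, l) # ps)) * disp (backward ((k, l) # ps)) =
      cis (k * l) * (cis (turn ps) * disp (backward ps)) +
      cis (turn ps) * cis (- turn ps) * (cis (k * l) * turn_disp (- k) l)"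
    by (simp add: cis_mult[symmetric] distrib_left mult.assoc)
  ultimately show ?case by simp
qed simp

lemma shortenable_mirror: "shortenable ps \<Longrightarrow> shortenable (mirror ps)"
  unfolding shortenable_def
  by (metis cis_cnj disp_mirror len_mirror turn_mirror valid_mirror)

lemma shortenable_backward:
  assumes "valid ps" "shortenable ps" shows "shortenable (backward ps)"
proof -
  obtain qs where qs: "valid qs" "0 < len qs" "len qs < len ps"
    "cis (turn qs) = cis (turn ps)" "disp qs = disp ps"
    using assms(2) unfolding shortenable_def by blast
  have "cis (turn ps) * disp (backward qs) = cis (turn ps) * disp (backward ps)"
    using disp_backward[OF assms(1)] disp_backward[OF qs(1)] qs(4,5) by simp
  then have "disp (backward qs) = disp (backward ps)" by simp
  moreover have "cis (- turn qs) = cis (- turn ps)" using qs(4) by (metis cis_cnj)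
  ultimately show ?thesis using qs unfolding shortenable_def
    by (intro exI[of _ "backward qs"]) auto
qed

section \<open>Programs that can be shortened\<close>

lemma one_minus_cos_le: "1 - cos x \<le> x\<^sup>2 / 2" for x :: real
proof -
  have "(sin (x / 2))\<^sup>2 \<le> (x / 2)\<^sup>2"
    using abs_sin_x_le_abs_x[of "x / 2"] by (simp only: abs_le_square_iff)
  then show ?thesis using cos_double_sin[of "x / 2"] by (simp add: power2_eq_square)
qed

lemma sin_lower: "0 \<le> x \<Longrightarrow> x - x ^ 3 / 6 \<le> sin x" for x :: real
proof -
  assume "0 \<le> x"
  have "sin 0 - 0 + 0 ^ 3 / 6 \<le> sin x - x + x ^ 3 / 6"
  proof (rule DERIV_nonneg_imp_nondecreasing[OF \<open>0 \<le> x\<close>, of "\<lambda>x. sin x - x + x ^ 3 / 6"])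
    fix y :: real
    have "((\<lambda>x. sin x - x + x ^ 3 / 6) has_real_derivative (cos y - 1 + y\<^sup>2 / 2)) (at y)"
      by (auto intro!: derivative_eq_intros)
    then show "\<exists>d. ((\<lambda>x. sin x - x + x ^ 3 / 6) has_real_derivative d) (at y) \<and> 0 \<le> d"
      using one_minus_cos_le[of y] by (intro exI[of _ "cos y - 1 + y\<^sup>2 / 2"]) auto
  qed
  then show ?thesis by simp
qed

lemma sin_less_self: "0 < x \<Longrightarrow> \<bar>sin x\<bar> < x" for x :: real
proof (cases "x \<le> 1")
  case True
  assume "0 < x"
  then obtain z where z: "0 < z" "z < x" "sin x - sin 0 = (x - 0) * cos z"
    using MVT2[of 0 x sin cos] by auto
  have "0 < cos z" using z True pi_ge_two by (intro cos_gt_zero_pi) auto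
  moreover have "cos z < cos 0" using z True pi_ge_two by (intro cos_monotone_0_pi) auto
  ultimately show ?thesis using z(3) \<open>0 < x\<close> by (simp add: abs_mult)
qed (use abs_sin_le_one[of x] in linarith)

lemma sin_diff_less:
  fixes x h :: real
  assumes "0 < h" shows "sin x - sin (x - h) < h"
proof -
  have "sin x - sin (x - h) = 2 * (sin (h / 2) * cos (x - h / 2))"
    using sin_diff_sin[of x "x - h"] by (simp add: field_simps)
  also have "\<bar>sin (h / 2) * cos (x - h / 2)\<bar> \<le> \<bar>sin (h / 2)\<bar>"
    unfolding abs_mult by (intro mult_left_le) auto
  then have "2 * (sin (h / 2) * cos (x - h / 2)) < h"
    using sin_less_self[of "h / 2"] assms by linarith
  finally show ?thesis .
qed

text \<open>Cut \<open>h\<close> off both outer arcs and \<open>2 h\<close> off the middle one, and insert a segment at half the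
  middle arc. The displacement lost lies along that segment and equals
  \<open>4 (sin (a / 2) - sin (a / 2 - h))\<close>, which is less than the length \<open>4 h\<close> removed and, because
  \<open>a / 2 \<le> \<pi> / 2\<close>, nonnegative.\<close>

lemma shortenable_RLR:
  assumes "0 < p" "0 < a" "a \<le> pi" "0 < q"
  shows "shortenable [(-1, p), (1, a), (-1, q)]"
proof -
  define h where "h = min (min p q) (a / 2) / 2"
  have h: "0 < h" "h < p" "h < q" "h < a / 2"
    using assms by (auto simp: h_def)
  define l where "l = 4 * (sin (a / 2) - sin (a / 2 - h))"
  have l0: "0 \<le> l" unfolding l_def
    using sin_monotone_2pi_le[of "a / 2 - h" "a / 2"] h assms by auto
  have l1: "l < 4 * h" unfolding l_def using sin_diff_less[of h "a / 2"] h by simp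
  let ?qs = "[(-1, p - h), (1, a / 2 - h), (0, l), (1, a / 2 - h), (-1, q - h)]"
  have "disp ?qs = disp [(-1, p), (1, a), (-1, q)]"
  proof -
    \<comment> \<open>Arcs telescope: only the directions at which the turning rate changes enter the displacement.\<close>
    have D: "disp [(-1, p'), (1, a'), (0, l'), (1, a''), (-1, q')] =
        \<i> * (2 * cis (- p') - 2 * cis (- p' + a' + a'') - 1 + cis (- p' + a' + a'' - q')) + l' * cis (- p' + a')"
      for p' a' l' a'' q'
    proof -
      have "cis (- p' + a') = cis (- p') * cis a'" "cis (- p' + a' + a'') = cis (- p') * cis a' * cis a''"
        "cis (- p' + a' + a'' - q') = cis (- p') * cis a' * cis a'' * cis (- q')"
        by (simp_all add: cis_mult)
      then show ?thesis by (simp add: turn_disp_left turn_disp_right turn_disp_straight algebra_simps)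
    qed
    have "of_real l = - 2 * \<i> * (cis (a / 2) - cis (- a / 2) - cis (a / 2 - h) + cis (h - a / 2))"
      by (simp add: l_def complex_eq_iff sin_diff cos_diff)
    then have "l * cis (- p + a / 2) = - 2 * \<i> * (cis (a / 2) - cis (- a / 2) - cis (a / 2 - h) + cis (h - a / 2)) * cis (- p + a / 2)"
      by (rule arg_cong)
    also have "\<dots> = - 2 * \<i> * (cis (a - p) - cis (- p) - cis (a - p - h) + cis (h - p))"
      by (simp add: cis_mult algebra_simps)
    finally have l_cis: "l * cis (- p + a / 2) = - 2 * \<i> * (cis (a - p) - cis (- p) - cis (a - p - h) + cis (h - p))" .
    have "disp ?qs = \<i> * (2 * cis (h - p) - 2 * cis (a - p - h) - 1 + cis (a - p - q)) + l * cis (- p + a / 2)"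
      using D[of "p - h" "a / 2 - h" l "a / 2 - h" "q - h"] by (simp add: algebra_simps)
    also have "\<dots> = \<i> * (2 * cis (- p) - 2 * cis (a - p) - 1 + cis (a - p - q))"
      unfolding l_cis by (simp add: algebra_simps)
    also have "\<dots> = disp [(-1, p), (1, a), (-1, q)]"
      using D[of p a 0 0 q] by (simp add: turn_disp_left turn_disp_right turn_disp_straight algebra_simps)
    finally show ?thesis .
  qed
  then show ?thesis
    using h l0 l1 unfolding shortenable_def by (intro exI[of _ ?qs]) auto
qed

text \<open>Moving sideways by \<open>c\<close> on a straight run of length \<open>p\<close> costs a length of order \<open>c\<^sup>2\<close> only: turn by a
  small angle, go straight, turn back, and continue straight.\<close>

lemma bump:
  fixes p :: real
  assumes "0 < p"
  obtains c0 K where "0 < c0"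
    "\<And>c. \<bar>c\<bar> \<le> c0 \<Longrightarrow> \<exists>qs. valid qs \<and> turn qs = 0 \<and> disp qs = Complex p c \<and> len qs \<le> p + K * c\<^sup>2"
proof -
  define c0 where "c0 = p / 2 * min 1 (p / 5)"
  define K where "K = 4 / p\<^sup>2 * (1 / 3 + 3 / 10 * p)"
  have K0: "0 \<le> K" using assms by (simp add: K_def)
  have pos: "\<exists>qs. valid qs \<and> turn qs = 0 \<and> disp qs = Complex p c \<and> len qs \<le> p + K * c\<^sup>2"
    if c: "0 < c" "c \<le> c0" for c
  proof -
    \<comment> \<open>With this angle the slanted segment has length about \<open>p / 2\<close>, which leaves room for both turns.\<close>
    define \<phi> where "\<phi> = 2 * c / p"
    have "c \<le> p / 2" "c \<le> p * p / 10" 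
    proof -
      have "c0 \<le> p / 2 * 1" "c0 \<le> p / 2 * (p / 5)"
        unfolding c0_def using assms by (intro mult_left_mono; simp)+
      then show "c \<le> p / 2" "c \<le> p * p / 10" using c by simp_all
    qed
    then have \<phi>: "0 < \<phi>" "\<phi> \<le> 1" "\<phi> \<le> p / 5" and c_eq: "c = p * \<phi> / 2"
      using c assms by (auto simp: \<phi>_def field_simps)
    have sin_lo: "\<phi> - \<phi>^3 / 6 \<le> sin \<phi>" using \<phi> by (intro sin_lower) auto
    have "\<phi>^3 \<le> \<phi>" using \<phi> power_decreasing[of 1 3 \<phi>] by simp
    then have sin_lo': "5 / 6 * \<phi> \<le> sin \<phi>" using sin_lo by simp
    have sin0: "0 < sin \<phi>" using sin_lo' \<phi> by linarith
    have cos_lo: "1 - cos \<phi> \<le> \<phi>\<^sup>2 / 2" by (rule one_minus_cos_le)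
    define l where "l = (c - 2 * (1 - cos \<phi>)) / sin \<phi>"
    have "\<phi>\<^sup>2 \<le> c" using \<phi> assms mult_left_mono[of \<phi> "p / 2" \<phi>] unfolding c_eq by (simp add: power2_eq_square mult.commute)
    then have "0 \<le> c - 2 * (1 - cos \<phi>)" using cos_lo by argo
    then have l0: "0 \<le> l" using sin0 unfolding l_def by simp
    have l_aux: "c - 2 * (1 - cos \<phi>) \<le> 3 / 5 * p * sin \<phi>"
    proof -
      have "c \<le> 3 / 5 * p * (5 / 6 * \<phi>)" using c_eq by simp
      also have "\<dots> \<le> 3 / 5 * p * sin \<phi>" using sin_lo' assms by (intro mult_left_mono) auto
      finally show ?thesis using cos_le_one[of \<phi>] by argo
    qed
    have l1: "l \<le> 3 / 5 * p" using sin0 l_aux unfolding l_def by (simp only: pos_divide_le_eq)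
    define m where "m = 2 * sin \<phi> + l * cos \<phi>"
    have "l * cos \<phi> \<le> l" using l0 by (intro mult_left_le) auto
    moreover have "sin \<phi> \<le> \<phi>" using \<phi> by (intro sin_x_le_x) auto
    ultimately have m: "m \<le> p" using l1 \<phi> unfolding m_def by linarith
    let ?qs = "[(1, \<phi>), (0, l), (-1, \<phi>), (0, p - m)]"
    have ls: "l * sin \<phi> = c - 2 * (1 - cos \<phi>)" using sin0 by (simp add: l_def)
    have "disp ?qs = - \<i> * (cis \<phi> - 1) + l * cis \<phi> + \<i> * (1 - cis \<phi>) + (p - m)"
    proof -
      have c: "cis \<phi> * (z * cis (- \<phi>)) = z" for z by (simp add: cis_mult mult.left_commute[of _ z])
      show ?thesis by (simp add: c turn_disp_left turn_disp_right turn_disp_straight cis_mult algebra_simps)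
    qed
    then have "disp ?qs = Complex p c"
      using ls by (simp add: complex_eq_iff m_def algebra_simps)
    moreover have "len ?qs \<le> p + K * c\<^sup>2"
    proof -
      have "l * (1 - cos \<phi>) \<le> 3 / 5 * p * (\<phi>\<^sup>2 / 2)"
        using l0 l1 cos_lo assms by (intro mult_mono) auto
      moreover have "\<phi> ^ 3 \<le> \<phi>\<^sup>2" using \<phi> power_decreasing[of 2 3 \<phi>] by simp
      ultimately have "2 * (\<phi> - sin \<phi>) + l * (1 - cos \<phi>) \<le> (1 / 3 + 3 / 10 * p) * \<phi>\<^sup>2"
        using sin_lo by (simp add: algebra_simps)
      also have "\<dots> = K * c\<^sup>2" using assms by (simp add: K_def \<phi>_def power2_eq_square field_simps)
      finally show ?thesis by (simp add: m_def algebra_simps)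
    qed
    ultimately show ?thesis using \<phi> l0 m by (intro exI[of _ ?qs]) auto
  qed
  have "\<exists>qs. valid qs \<and> turn qs = 0 \<and> disp qs = Complex p c \<and> len qs \<le> p + K * c\<^sup>2"
    if c: "\<bar>c\<bar> \<le> c0" for c
  proof -
    consider "0 < c" | "c = 0" | "c < 0" by linarith
    then show ?thesis
    proof cases
      case 1 then show ?thesis using pos c by auto
    next
      case 2
      then show ?thesis using assms
        by (intro exI[of _ "[(0, p)]"]) (auto simp: turn_disp_def complex_eq_iff)
    next
      case 3
      then obtain qs where "valid qs" "turn qs = 0" "disp qs = Complex p (- c)" "len qs \<le> p + K * (- c)\<^sup>2"
        using pos[of "- c"] c by auto
      then show ?thesis by (intro exI[of _ "mirror qs"]) (auto simp: complex_eq_iff)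
    qed
  qed
  moreover have "0 < c0" using assms by (simp add: c0_def)
  ultimately show ?thesis using that by blast
qed

text \<open>The form in which bumps are used: a first-order gain \<open>T\<close> pays for a sideways
  displacement \<open>c\<close> of first order, because the cost of the latter is of second order.\<close>

lemma eventually_bump:
  fixes p :: real and c T :: "real \<Rightarrow> real"
  assumes "0 < p" "0 < T'" "(T has_real_derivative T') (at 0)" "T 0 = 0"
    and "(c has_real_derivative c') (at 0)" "c 0 = 0"
  shows "eventually (\<lambda>h. \<exists>qs. valid qs \<and> turn qs = 0 \<and> disp qs = Complex p (c h) \<and> len qs < p + T h)
           (at_right 0)"
proof -
  obtain c0 K where c0: "0 < c0" and bump:
    "\<And>c. \<bar>c\<bar> \<le> c0 \<Longrightarrow> \<exists>qs. valid qs \<and> turn qs = 0 \<and> disp qs = Complex p c \<and> len qs \<le> p + K * c\<^sup>2"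
    using bump[OF assms(1)] by blast
  have "((\<lambda>h. T h - K * (c h)\<^sup>2) has_real_derivative T') (at 0)"
    by (auto intro!: derivative_eq_intros assms(3,5) simp: assms(6))
  then obtain d where d: "0 < d" "\<And>h. 0 < h \<Longrightarrow> h < d \<Longrightarrow> 0 < T h - K * (c h)\<^sup>2"
    using DERIV_pos_inc_right[of "\<lambda>h. T h - K * (c h)\<^sup>2" T' 0] assms(2,4,6) by auto
  have 1: "eventually (\<lambda>h. 0 < T h - K * (c h)\<^sup>2) (at_right 0)"
    using d by (intro eventually_at_right_real[THEN eventually_mono, of 0 d]) auto
  have "(c \<longlongrightarrow> c 0) (at 0)"
    using assms(5) DERIV_isCont isContD by blast
  then have "(c \<longlongrightarrow> 0) (at_right 0)" using assms(6) filterlim_at_split by metis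
  then have 2: "eventually (\<lambda>h. \<bar>c h\<bar> < c0) (at_right 0)"
    using c0 by (auto simp: tendsto_iff dist_real_def)
  show ?thesis using 1 2
  proof eventually_elim
    case (elim h)
    then obtain qs where "valid qs" "turn qs = 0" "disp qs = Complex p (c h)" "len qs \<le> p + K * (c h)\<^sup>2"
      using bump[of "c h"] by auto
    then show ?case using elim(1) by (intro exI[of _ qs]) auto
  qed
qed

lemma eventually_right_less: "0 < (b::real) \<Longrightarrow> eventually (\<lambda>h. h < b) (at_right 0)"
  using eventually_at_right_real[of 0 b] by (auto elim: eventually_mono)

lemma cos_less_one: "0 < a \<Longrightarrow> a < 2 * pi \<Longrightarrow> cos a < 1" for a :: real
  using sin_gt_zero[of "a / 2"] cos_double_sin[of "a / 2"] by (simp add: zero_less_power2)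

text \<open>Shorten both arcs by \<open>h\<close>. The first segment absorbs the resulting displacement, its component
  along the segment by a change of length and the perpendicular one by a bump. To first
  order the length drops by \<open>2 (1 - cos a) h\<close>.\<close>

lemma shortenable_SLR:
  assumes "0 < p" "0 < a" "a < 2 * pi" "0 < q"
  shows "shortenable [(0, p), (1, a), (-1, q)]"
proof -
  let ?e = "\<lambda>h. 2 * (sin (a - h) - sin a)"
  let ?c = "\<lambda>h. 2 * (cos (a - h) - cos a)"
  have "eventually (\<lambda>h. \<exists>qs. valid qs \<and> turn qs = 0 \<and> disp qs = Complex (p / 2) (?c h) \<and>
      len qs < p / 2 + (2 * h + ?e h)) (at_right 0)"
    using assms cos_less_one[of a]
    by (intro eventually_bump[where T' = "2 - 2 * cos a" and c' = "2 * sin a"])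
       (auto intro!: derivative_eq_intros)
  moreover have "(?e \<longlongrightarrow> 2 * (sin (a - 0) - sin a)) (at_right 0)" by (intro tendsto_intros)
  then have "eventually (\<lambda>h. ?e h < p / 2) (at_right 0)"
    using assms(1) by (intro order_tendstoD) auto
  moreover note eventually_right_less[OF assms(2)] eventually_right_less[OF assms(4)]
    eventually_at_right_less[of 0]
  ultimately have "eventually (\<lambda>h::real. shortenable [(0, p), (1, a), (-1, q)]) (at_right 0)"
  proof eventually_elim
    case (elim h)
    then obtain qs where qs: "valid qs" "turn qs = 0" "disp qs = Complex (p / 2) (?c h)"
      "len qs < p / 2 + (2 * h + ?e h)" by blast
    let ?qs = "qs @ [(0, p / 2 - ?e h), (1, a - h), (-1, q - h)]"
    have D: "disp [(0, p'), (1, a'), (-1, q')] = p' + \<i> * (1 - 2 * cis a' + cis (a' - q'))" for p' a' q'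
    proof -
      have "cis (a' - q') = cis a' * cis (- q')" by (simp add: cis_mult)
      then show ?thesis by (simp add: turn_disp_left turn_disp_right turn_disp_straight algebra_simps)
    qed
    have "disp ?qs = disp [(0, p), (1, a), (-1, q)]"
      unfolding disp_append D qs by (simp add: complex_eq_iff algebra_simps)
    moreover have "0 < len ?qs" using valid_len[OF qs(1)] elim by simp
    ultimately show ?case
      using qs elim unfolding shortenable_def by (intro exI[of _ ?qs]) auto
  qed
  then show ?thesis by simp
qed

text \<open>If \<open>a \<noteq> \<pi>\<close>, the directions of the two segments are independent, so a bump by \<open>c\<close> on the first
  segment can be compensated exactly by shortening the segments by \<open>- c cot a\<close> and \<open>c / sin a\<close>; together these
  are \<open>c tan (a / 2)\<close>, positive for the right sign of \<open>c\<close>. If \<open>a = \<pi>\<close>, the segments are antiparallel and equal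
  parts of both can be deleted.\<close>

lemma shortenable_SLS:
  assumes "0 < p" "0 < a" "a < 2 * pi" "0 < q"
  shows "shortenable [(0, p), (1, a), (0, q)]"
proof (cases "a = pi")
  case True
  let ?m = "min p q"
  show ?thesis
    using assms True pi_gt_zero unfolding shortenable_def
    by (intro exI[of _ "[(0, p - ?m), (1, pi), (0, q - ?m)]"])
       (auto simp: turn_disp_def complex_eq_iff min_def simp del: pi_gt_zero)
next
  case False
  have s: "sin a \<noteq> 0"
    using sin_zero_pi_iff[of "a - pi"] assms False by (auto simp: sin_diff)
  \<comment> \<open>The gain per unit of sideways shift, \<open>\<bar>tan (a / 2)\<bar>\<close>.\<close>
  define e where "e = (1 - cos a) * sgn (sin a) / sin a"
  have e: "0 < e" using s cos_less_one assms by (auto simp: e_def sgn_if divide_neg_neg)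
  let ?c = "\<lambda>h. h * sgn (sin a)"
  let ?e1 = "\<lambda>h. - ?c h * cos a / sin a"
  let ?e2 = "\<lambda>h. ?c h / sin a"
  have "eventually (\<lambda>h. \<exists>qs. valid qs \<and> turn qs = 0 \<and> disp qs = Complex (p / 2) (?c h) \<and>
      len qs < p / 2 + h * e) (at_right 0)"
    using assms e
    by (intro eventually_bump[where T' = e and c' = "sgn (sin a)"])
       (auto intro!: derivative_eq_intros)
  moreover have "(?e1 \<longlongrightarrow> - (0 * sgn (sin a)) * cos a / sin a) (at_right 0)"
    by (intro tendsto_intros s)
  then have "eventually (\<lambda>h. ?e1 h < p / 2) (at_right 0)"
    using assms(1) by (intro order_tendstoD) auto
  moreover have "(?e2 \<longlongrightarrow> 0 * sgn (sin a) / sin a) (at_right 0)"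
    by (intro tendsto_intros s)
  then have "eventually (\<lambda>h. ?e2 h < q) (at_right 0)"
    using assms(4) by (intro order_tendstoD) auto
  ultimately have "eventually (\<lambda>h::real. shortenable [(0, p), (1, a), (0, q)]) (at_right 0)"
  proof eventually_elim
    case (elim h)
    then obtain qs where qs: "valid qs" "turn qs = 0" "disp qs = Complex (p / 2) (?c h)"
      "len qs < p / 2 + h * e" by blast
    let ?qs = "qs @ [(0, p / 2 - ?e1 h), (1, a), (0, q - ?e2 h)]"
    have "disp ?qs = disp [(0, p), (1, a), (0, q)]"
      using s by (simp add: qs turn_disp_def complex_eq_iff field_simps)
    moreover have "h * e = ?e1 h + ?e2 h" using s by (simp add: e_def field_simps)
    moreover have "0 < len ?qs" using valid_len[OF qs(1)] elim assms by simp
    ultimately show ?case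
      using qs elim assms unfolding shortenable_def by (intro exI[of _ ?qs]) auto
  qed
  then show ?thesis by simp
qed

lemma polar_right_half: "0 < Re w \<Longrightarrow> w = of_real (norm w) * cis (arctan (Im w / Re w))"
  using rcis_cmod_Arg[of w] arg_conv_arctan[of w] by (simp add: rcis_def)

text \<open>Let the three inner switching directions turn by \<open>g1\<close>, \<open>g2\<close>, \<open>g3\<close>. The displacement is then
  preserved as soon as the alternating sum of these directions is; the length changes
  by \<open>2 (g2 - g1 - g3)\<close>.\<close>

lemma RLRL_disp:
  fixes p a b q g1 g2 g3 :: real
  assumes "cis (g1 - p) - cis (a - p + g2) + cis (a - p - b + g3) =
           cis (- p) - cis (a - p) + cis (a - p - b)"
  shows "disp [(-1, p - g1), (1, a + g2 - g1), (-1, b + g2 - g3), (1, q - g3)] =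
         disp [(-1, p), (1, a), (-1, b), (1, q)]"
proof -
  have D: "disp [(-1, p'), (1, a'), (-1, b'), (1, q')] =
      \<i> * (2 * cis (- p') - 2 * cis (a' - p') + 2 * cis (a' - p' - b') - 1 - cis (a' - p' - b' + q'))"
    for p' a' b' q' :: real
  proof -
    have "cis (a' - p') = cis (- p') * cis a'" "cis (a' - p' - b') = cis (- p') * cis a' * cis (- b')"
      "cis (a' - p' - b' + q') = cis (- p') * cis a' * cis (- b') * cis q'"
      by (simp_all add: cis_mult)
    then show ?thesis by (simp add: turn_disp_left turn_disp_right algebra_simps)
  qed
  have e: "- (p - g1) = g1 - p" "a + g2 - g1 - (p - g1) = a - p + g2"
    "a - p + g2 - (b + g2 - g3) = a - p - b + g3"
    "a - p - b + g3 + (q - g3) = a - p - b + q" by auto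
  show ?thesis unfolding D e using assms by (simp add: algebra_simps) algebra
qed

text \<open>Rotate so that the second switching direction is \<open>1\<close>. Then the first and the third add up to
  \<open>p0 cis (- s)\<close>, with \<open>s\<close> and \<open>n0\<close> half the sum and half the difference of the middle arcs. If the second
  direction turns by \<open>t\<close>, the sum of the other two must become \<open>r cis (\<mu> - s)\<close> with \<open>r\<close> and \<open>\<mu>\<close> as defined
  below, and this is possible with directions \<open>n\<close> to either side of the sum whenever \<open>r \<le> 2\<close>. For
  small \<open>t < 0\<close> the modulus \<open>r\<close> decreases, because \<open>sin s < 0\<close>, and the change of length
  \<open>2 (t - 2 \<mu>)\<close> is negative, because its derivative at \<open>0\<close> is a positive multiple of
  \<open>cos n0 - cos s = 2 sin (a / 2) sin (b / 2)\<close>. That \<open>r\<close> decreases matters for \<open>a = b\<close>, where it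
  starts at the extreme value \<open>2\<close>. The condition \<open>b \<le> a\<close> makes \<open>n0 \<ge> 0\<close>, so that \<open>arccos\<close> recovers \<open>n0\<close>.\<close>

lemma shortenable_RLRL_le:
  assumes "0 < p" "pi < a" "a < 2 * pi" "pi < b" "b \<le> a" "0 < q"
  shows "shortenable [(-1, p), (1, a), (-1, b), (1, q)]"
proof -
  define s n0 p0 where "s = (a + b) / 2" "n0 = (a - b) / 2" "p0 = 2 * cos n0"
  have s: "pi < s" "s < 2 * pi" and n0: "0 \<le> n0" "n0 < pi / 2"
    using assms by (auto simp: s_n0_p0_def)
  have p0: "0 < p0" "p0 \<le> 2" using n0 cos_gt_zero_pi[of n0] by (auto simp: s_n0_p0_def)
  have ab: "a = s + n0" "b = s - n0" by (auto simp: s_n0_p0_def field_simps)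
  have sins: "sin s < 0" using s sin_lt_zero by auto
  let ?x = "\<lambda>t. p0 + cos (t + s) - cos s"
  let ?y = "\<lambda>t. sin (t + s) - sin s"
  define \<mu> where "\<mu> t = arctan (?y t / ?x t)" for t
  define r where "r t = sqrt ((?x t)\<^sup>2 + (?y t)\<^sup>2)" for t
  define n where "n t = arccos (r t / 2)" for t
  have x_lim: "(?x \<longlongrightarrow> p0 + cos (0 + s) - cos s) (at_left 0)"
    and y_lim: "(?y \<longlongrightarrow> sin (0 + s) - sin s) (at_left 0)"
    by (intro tendsto_intros)+
  have \<mu>_lim: "(\<mu> \<longlongrightarrow> arctan ((sin (0 + s) - sin s) / (p0 + cos (0 + s) - cos s))) (at_left 0)"
    unfolding \<mu>_def[abs_def] using p0 by (intro tendsto_intros) auto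
  have r_lim: "(r \<longlongrightarrow> p0) (at_left 0)"
  proof -
    have "(r \<longlongrightarrow> sqrt ((p0 + cos (0 + s) - cos s)\<^sup>2 + (sin (0 + s) - sin s)\<^sup>2)) (at_left 0)"
      unfolding r_def[abs_def] by (intro tendsto_intros)
    then show ?thesis using p0 by simp
  qed
  have r_less: "eventually (\<lambda>t. r t < p0) (at_left 0)"
  proof -
    have "((\<lambda>t. (?x t)\<^sup>2 + (?y t)\<^sup>2) has_real_derivative (- 2 * p0 * sin s)) (at 0)"
      by (auto intro!: derivative_eq_intros)
    then obtain d where d: "0 < d" "\<And>h. 0 < h \<Longrightarrow> h < d \<Longrightarrow> (?x (0 - h))\<^sup>2 + (?y (0 - h))\<^sup>2 < p0\<^sup>2"
      using DERIV_pos_inc_left[of "\<lambda>t. (?x t)\<^sup>2 + (?y t)\<^sup>2" "- 2 * p0 * sin s" 0] p0 sins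
      by (auto simp: mult_pos_neg)
    have "r t < p0" if "t \<in> {-d<..<0}" for t
      unfolding r_def using d(2)[of "- t"] that p0
      by (intro real_less_lsqrt) auto
    then show ?thesis using d(1)
      by (intro eventually_at_left_real[THEN eventually_mono, of "- d" 0]) auto
  qed
  have \<mu>_less: "eventually (\<lambda>t. t - 2 * \<mu> t < 0) (at_left 0)"
  proof -
    have "1 - 2 * cos s / p0 = 2 * (cos n0 - cos s) / p0" using p0 by (simp add: s_n0_p0_def field_simps)
    moreover have "cos s < cos n0"
    proof -
      have "cos n0 - cos s = 2 * sin (a / 2) * sin (b / 2)"
        using cos_diff_cos[of n0 s] by (simp add: s_n0_p0_def field_simps)
      moreover have "0 < sin (a / 2)" "0 < sin (b / 2)" using assms by (auto intro!: sin_gt_zero)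
      ultimately show ?thesis by (metis diff_gt_0_iff_gt mult_pos_pos zero_less_numeral)
    qed
    ultimately have D: "0 < 1 - 2 * cos s / p0" using p0 by simp
    have "((\<lambda>t. t - 2 * \<mu> t) has_real_derivative (1 - 2 * cos s / p0)) (at 0)"
      unfolding \<mu>_def using p0 by (auto intro!: derivative_eq_intros simp: field_simps power2_eq_square)
    then obtain d where d: "0 < d" "\<And>h. 0 < h \<Longrightarrow> h < d \<Longrightarrow> (0 - h) - 2 * \<mu> (0 - h) < 0 - 2 * \<mu> 0"
      using DERIV_pos_inc_left[of "\<lambda>t. t - 2 * \<mu> t" _ 0] D by blast
    have "t - 2 * \<mu> t < 0" if "t \<in> {-d<..<0}" for t
      using d(2)[of "- t"] that by (auto simp: \<mu>_def)
    then show ?thesis using d(1)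
      by (intro eventually_at_left_real[THEN eventually_mono, of "- d" 0]) auto
  qed
  have n_lim: "(n \<longlongrightarrow> n0) (at_left 0)"
  proof -
    have "continuous_on {-1..1} arccos" using continuous_on_arccos' by blast
    moreover have "((\<lambda>t. r t / 2) \<longlongrightarrow> p0 / 2) (at_left 0)"
      using r_lim by (intro tendsto_intros) auto
    moreover have "eventually (\<lambda>t. r t / 2 \<in> {-1..1}) (at_left 0)"
      using r_less p0 by (auto elim!: eventually_mono simp: r_def intro: order_trans[of _ 0])
    ultimately have "((\<lambda>t. arccos (r t / 2)) \<longlongrightarrow> arccos (p0 / 2)) (at_left 0)"
      using p0 by (intro continuous_on_tendsto_compose[where f = arccos and s = "{-1..1}"]) auto
    then show ?thesis using n0 by (simp add: n_def[abs_def] s_n0_p0_def arccos_cos)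
  qed
  let ?g1 = "\<lambda>t. \<mu> t - (n t - n0)" and ?g3 = "\<lambda>t. \<mu> t + (n t - n0)"
  have \<mu>0: "(\<mu> \<longlongrightarrow> 0) (at_left 0)" using \<mu>_lim by simp
  have t0: "((\<lambda>t. t) \<longlongrightarrow> 0) (at_left (0::real))" by (rule tendsto_ident_at)
  have g1: "(?g1 \<longlongrightarrow> 0 - (n0 - n0)) (at_left 0)" and g3: "(?g3 \<longlongrightarrow> 0 + (n0 - n0)) (at_left 0)"
    by (intro tendsto_intros \<mu>0 n_lim)+
  have "eventually (\<lambda>t. ?g1 t < p) (at_left 0)" using g1 assms by (intro order_tendstoD(2)) auto
  moreover have "eventually (\<lambda>t. ?g3 t < q) (at_left 0)" using g3 assms by (intro order_tendstoD(2)) auto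
  moreover have "eventually (\<lambda>t. 0 < a + t - ?g1 t) (at_left 0)"
  proof -
    have "((\<lambda>t. a + t - ?g1 t) \<longlongrightarrow> a + 0 - (0 - (n0 - n0))) (at_left 0)"
      by (intro tendsto_intros g1)
    from order_tendstoD(1)[OF this, of 0] show ?thesis using assms(2,4) pi_gt_zero by simp
  qed
  moreover have "eventually (\<lambda>t. 0 < b + t - ?g3 t) (at_left 0)"
  proof -
    have "((\<lambda>t. b + t - ?g3 t) \<longlongrightarrow> b + 0 - (0 + (n0 - n0))) (at_left 0)"
      by (intro tendsto_intros g3)
    from order_tendstoD(1)[OF this, of 0] show ?thesis using assms(2,4) pi_gt_zero by simp
  qed
  moreover have "eventually (\<lambda>t. 0 < ?x t) (at_left 0)"
    using x_lim p0 by (intro order_tendstoD(1)) auto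
  moreover note r_less \<mu>_less
  ultimately have "eventually (\<lambda>t::real. shortenable [(-1, p), (1, a), (-1, b), (1, q)]) (at_left 0)"
  proof eventually_elim
    case (elim t)
    let ?qs = "[(-1, p - ?g1 t), (1, a + t - ?g1 t), (-1, b + t - ?g3 t), (1, q - ?g3 t)]"
    have "complex_of_real (r t) * cis (\<mu> t) = Complex (?x t) (?y t)"
      using polar_right_half[of "Complex (?x t) (?y t)"] elim(5)
      by (simp add: r_def \<mu>_def complex_norm)
    then have W: "complex_of_real (r t) * cis (\<mu> t) = p0 + (cis t - 1) * cis s"
      by (simp add: complex_eq_iff cos_add sin_add algebra_simps)
    have "0 \<le> r t" by (simp add: r_def)
    then have "cos (n t) = r t / 2" unfolding n_def using elim(6) p0 by (intro cos_arccos) auto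
    then have nn: "cis (n t) + cis (- n t) = of_real (r t)" by (simp add: complex_eq_iff)
    have nn0: "cis n0 + cis (- n0) = of_real p0" by (simp add: complex_eq_iff s_n0_p0_def)
    have "cis (?g1 t - p) - cis (a - p + t) + cis (a - p - b + ?g3 t) =
           cis (- p) - cis (a - p) + cis (a - p - b)"
    proof -
      define P N0 N0' where "P = cis (- p)" "N0 = cis n0" "N0' = cis (- n0)"
      note d = this
      have "cis (?g1 t - p) = cis (\<mu> t) * cis (- n t) * N0 * P" "cis (a - p + t) = cis s * N0 * P * cis t"
        "cis (a - p - b + ?g3 t) = N0 * P * cis (\<mu> t) * cis (n t)" "cis (a - p) = cis s * N0 * P"
        "cis (a - p - b) = N0 * N0 * P"
        unfolding ab d cis_mult by (auto intro!: arg_cong[of _ _ cis])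
      moreover have "N0 * N0' = 1" by (simp add: d cis_mult)
      moreover note W nn nn0[folded d] d(1)[symmetric]
      ultimately show ?thesis by algebra
    qed
    then have "disp ?qs = disp [(-1, p), (1, a), (-1, b), (1, q)]" by (rule RLRL_disp)
    moreover have "turn ?qs = turn [(-1, p), (1, a), (-1, b), (1, q)]" by simp
    then have "cis (turn ?qs) = cis (turn [(-1, p), (1, a), (-1, b), (1, q)])" by (rule arg_cong)
    ultimately show ?case
      using elim unfolding shortenable_def by (intro exI[of _ ?qs] conjI) auto
  qed
  then show ?thesis by simp
qed

lemma shortenable_RLRL:
  assumes "0 < p" "pi < a" "a < 2 * pi" "pi < b" "b < 2 * pi" "0 < q"
  shows "shortenable [(-1, p), (1, a), (-1, b), (1, q)]"
proof (cases "b \<le> a")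
  case True then show ?thesis using assms shortenable_RLRL_le by simp
next
  case False
  then have "shortenable (backward [(-1, q), (1, b), (-1, a), (1, p)])"
    using assms pi_gt_zero by (intro shortenable_backward shortenable_RLRL_le) auto
  then show ?thesis by simp
qed

section \<open>Shortest direction functions\<close>

text \<open>Programs suffice as competitors because all shortcuts below are concatenations of arcs and segments.\<close>

definition shortest :: "(real \<Rightarrow> complex) \<Rightarrow> real \<Rightarrow> real \<Rightarrow> bool" where
  "shortest v a b \<longleftrightarrow> steering v a b \<and>
     (\<forall>ps. valid ps \<and> 0 < len ps \<and> v b = v a * cis (turn ps) \<and> integral {a..b} v = v a * disp ps
       \<longrightarrow> b - a \<le> len ps)"

lemma shortestD:
  "shortest v a b \<Longrightarrow> valid ps \<Longrightarrow> 0 < len ps \<Longrightarrow> v b = v a * cis (turn ps) \<Longrightarrow>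
   integral {a..b} v = v a * disp ps \<Longrightarrow> b - a \<le> len ps"
  unfolding shortest_def by blast

lemma shortest_imp_steering: "shortest v a b \<Longrightarrow> steering v a b"
  unfolding shortest_def by blast

definition along :: "(real \<Rightarrow> complex) \<Rightarrow> real \<Rightarrow> real \<Rightarrow> real \<Rightarrow> bool" where
  "along v k a b \<longleftrightarrow> (\<forall>t\<in>{a..b}. v t = v a * cis (k * (t - a)))"

lemma alongD: "along v k a b \<Longrightarrow> a \<le> t \<Longrightarrow> t \<le> b \<Longrightarrow> v t = v a * cis (k * (t - a))"
  unfolding along_def by (meson atLeastAtMost_iff)

lemma alongI: "(\<And>t. a \<le> t \<Longrightarrow> t \<le> b \<Longrightarrow> v t = v a * cis (k * (t - a))) \<Longrightarrow> along v k a b"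
  unfolding along_def by (meson atLeastAtMost_iff)

lemma along_subinterval:
  assumes "along v k a b" "a \<le> a'" "b' \<le> b"
  shows "along v k a' b'"
proof (rule alongI)
  fix t assume t: "a' \<le> t" "t \<le> b'"
  have "v t = v a * cis (k * (t - a))" "v a' = v a * cis (k * (a' - a))"
    using assms t by (intro alongD[OF assms(1)]; simp)+
  then show "v t = v a' * cis (k * (t - a'))"
    by (simp add: cis_mult algebra_simps)
qed

lemma along_trivial: "along v k a a"
  by (simp add: along_def)

lemma along_join:
  assumes "along v k a b" "along v k b c" "a \<le> b"
  shows "along v k a c"
proof (rule alongI)
  fix t assume t: "a \<le> t" "t \<le> c"
  show "v t = v a * cis (k * (t - a))"
  proof (cases "t \<le> b")
    case True
    then show ?thesis using alongD[OF assms(1)] t by blast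
  next
    case False
    then have "v t = v b * cis (k * (t - b))" "v b = v a * cis (k * (b - a))"
      using assms(3) t alongD[OF assms(2), of t] alongD[OF assms(1), of b] by simp_all
    then show ?thesis by (simp add: cis_mult algebra_simps)
  qed
qed

lemma integral_along:
  assumes "along v k a b" "a \<le> b" "k \<in> {-1, 0, 1}"
  shows "integral {a..b} v = v a * turn_disp k (b - a)"
proof -
  have "integral {a..b} v = integral {a..b} (\<lambda>t. v a * cis (k * (t - a)))"
    by (intro integral_cong alongD[OF assms(1)]) simp_all
  also have "\<dots> = integral {0..b - a} (\<lambda>t. v a * cis (k * t))"
    using integral_shift_interval[of 0 "b - a" "\<lambda>t. v a * cis (k * t)" "- a"]
    by (simp add: continuous_intros)
  also have "\<dots> = v a * turn_disp k (b - a)" using assms by (intro integral_turn) auto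
  finally show ?thesis .
qed

fun follows :: "(real \<Rightarrow> complex) \<Rightarrow> real \<Rightarrow> program \<Rightarrow> bool" where
  "follows v a [] = True"
| "follows v a ((k, l) # ps) \<longleftrightarrow> along v k a (a + l) \<and> follows v (a + l) ps"

lemma follows_end: 
  assumes "valid ps" "follows v a ps"
  shows "v (a + len ps) = v a * cis (turn ps)"
  using assms
proof (induction v a ps rule: follows.induct)
  case (2 v a k l ps)
  then have "v (a + l) = v a * cis (k * l)" using alongD[of v k a "a + l" "a + l"] by simp
  then show ?case using 2 by (simp add: cis_mult[symmetric] add.assoc)
qed simp

lemma follows_integral:
  assumes "valid ps" "follows v a ps" "v integrable_on {a..a + len ps}"
  shows "integral {a..a + len ps} v = v a * disp ps"
  using assms
proof (induction v a ps rule: follows.induct)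
  case (2 v a k l ps)
  then have v: "v (a + l) = v a * cis (k * l)" using alongD[of v k a "a + l" "a + l"] by simp
  have l: "0 \<le> l" "0 \<le> len ps" using 2 valid_len by auto
  have int: "v integrable_on {a + l..a + l + len ps}"
    using 2(4) l by (intro integrable_subinterval_real[OF 2(4)]) auto
  have e: "a + len ((k, l) # ps) = a + l + len ps" by simp
  have "integral {a..a + len ((k, l) # ps)} v = integral {a..a + l} v + integral {a + l..a + l + len ps} v"
    using 2(4) l unfolding e by (intro Henstock_Kurzweil_Integration.integral_combine[symmetric]) auto
  also have "integral {a..a + l} v = v a * turn_disp k l"
    using 2 integral_along[of v k a "a + l"] by simp
  also have "integral {a + l..a + l + len ps} v = v (a + l) * disp ps"
    using 2 int by simp
  finally show ?case by (simp add: v algebra_simps)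
qed simp

lemma not_shortest_if_shortenable:
  assumes "valid ps" "follows v a ps" "shortenable ps"
  shows "\<not> shortest v a (a + len ps)"
proof
  assume sh: "shortest v a (a + len ps)"
  obtain qs where qs: "valid qs" "0 < len qs" "len qs < len ps"
    "cis (turn qs) = cis (turn ps)" "disp qs = disp ps"
    using assms(3) unfolding shortenable_def by blast
  have "integral {a..a + len ps} v = v a * disp qs"
    using follows_integral[OF assms(1,2)] steering_integrable[OF shortest_imp_steering[OF sh]] qs(5) by simp
  moreover have "v (a + len ps) = v a * cis (turn qs)"
    using follows_end[OF assms(1,2)] qs(4) by simp
  ultimately show False using shortestD[OF sh qs(1,2)] qs(3) by simp
qed

text \<open>Replacing the part between \<open>a\<close> and \<open>b\<close> by a program with the same end directions and the same
  displacement yields a competitor for the whole.\<close>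

lemma shortest_minimal:
  assumes "steering v 0 s"
    and min: "\<And>w T. 0 < T \<Longrightarrow> realises (v 0) (v s) (integral {0..s} v) T w \<Longrightarrow> s \<le> T"
    and ab: "0 \<le> a" "a \<le> b" "b \<le> s"
  shows "shortest v a b"
  unfolding shortest_def
proof (intro conjI allI impI)
  show st: "steering v a b" using assms by (auto intro: steering_subinterval)
  fix ps
  assume "valid ps \<and> 0 < len ps \<and> v b = v a * cis (turn ps) \<and> integral {a..b} v = v a * disp ps"
  then have ps: "valid ps" "0 < len ps"
    and eqs: "v b = v a * cis (turn ps)" "integral {a..b} v = v a * disp ps" by blast+
  have na: "norm (v a) = 1" using st unfolding steering_def by auto
  obtain w where "realises (v a) (v b) (integral {a..b} v) (len ps) w"
    using program_realises[OF ps(1) na] unfolding eqs[symmetric] by blast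
  note mid = this
  have outer1: "realises (v 0) (v a) (integral {0..a} v) (a - 0) (\<lambda>t. v (t + 0))"
    using ab by (intro realises_restrict[of v 0 a] steering_subinterval[OF assms(1)]) auto
  have outer2: "realises (v b) (v s) (integral {b..s} v) (s - b) (\<lambda>t. v (t + b))"
    using ab by (intro realises_restrict[of v b s] steering_subinterval[OF assms(1)]) auto
  obtain u1 where "realises (v 0) (v b) (integral {0..a} v + integral {a..b} v) (a - 0 + len ps) u1"
    using realises_join[OF outer1 mid] by blast
  then obtain u where u:
    "realises (v 0) (v s) (integral {0..a} v + integral {a..b} v + integral {b..s} v) (a - 0 + len ps + (s - b)) u"
    using realises_join[OF _ outer2] by blast
  have "integral {0..a} v + integral {a..b} v = integral {0..b} v"
    "integral {0..b} v + integral {b..s} v = integral {0..s} v"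
    using ab by (intro Henstock_Kurzweil_Integration.integral_combine
        steering_integrable steering_subinterval[OF assms(1)]; simp)+
  then have r: "realises (v 0) (v s) (integral {0..s} v) (a - 0 + len ps + (s - b)) u"
    using u by (simp only:)
  have "0 < a - 0 + len ps + (s - b)" using ps ab by simp
  from min[OF this r] show "b - a \<le> len ps" by simp
qed

lemma turn_disp_full_turn: "k \<in> {-1, 1} \<Longrightarrow> turn_disp k (l + 2 * pi) = turn_disp k l"
  by (auto simp: turn_disp_def)

text \<open>A full circle has no displacement and can be deleted.\<close>

lemma arc_le_2pi:
  assumes "shortest v a b" "along v k a b" "k \<in> {-1, 1}"
  shows "b - a \<le> 2 * pi"
proof (rule ccontr)
  assume *: "\<not> b - a \<le> 2 * pi"
  have ab: "a \<le> b" using shortest_imp_steering[OF assms(1)] unfolding steering_def by simp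
  have "cis (k * (b - a)) = cis (k * (b - a - 2 * pi))"
    using assms(3) by (auto simp: complex_eq_iff sin_diff cos_diff sin_add cos_add)
  moreover have "v b = v a * cis (k * (b - a))"
    using ab by (intro alongD[OF assms(2)]) auto
  moreover have "integral {a..b} v = v a * turn_disp k (b - a)"
    using ab assms by (intro integral_along) auto
  moreover have "turn_disp k (b - a) = turn_disp k (b - a - 2 * pi)"
    using turn_disp_full_turn[OF assms(3), of "b - a - 2 * pi"] by simp
  ultimately have "v b = v a * cis (turn [(k, b - a - 2 * pi)])"
    "integral {a..b} v = v a * disp [(k, b - a - 2 * pi)]"
    by simp_all
  then have "b - a \<le> len [(k, b - a - 2 * pi)]"
    using * assms(3) by (intro shortestD[OF assms(1)]) auto
  then show False using pi_gt_zero by simp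
qed

lemma shortest_shift:
  assumes "shortest v a b"
  shows "shortest (\<lambda>t. v (t + a)) 0 (b - a)"
proof -
  have st: "steering v a b" using assms by (rule shortest_imp_steering)
  have i: "integral {0..b - a} (\<lambda>t. v (t + a)) = integral {a..b} v"
    using integral_shift_interval[of a b v a] steering_continuous[OF st] by simp
  have "steering (\<lambda>t. v (t + a)) (a - a) (b - a)" using st by (rule steering_shift)
  then show ?thesis using shortestD[OF assms] unfolding shortest_def i by simp
qed

lemma along_shift: "along (\<lambda>t. v (t + c)) k a b \<Longrightarrow> along v k (a + c) (b + c)"
proof (rule alongI)
  fix t assume *: "along (\<lambda>t. v (t + c)) k a b" "a + c \<le> t" "t \<le> b + c"
  show "v t = v (a + c) * cis (k * (t - (a + c)))"
    using alongD[OF *(1), of "t - c"] *(2,3) by (simp add: algebra_simps)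
qed

section \<open>Angles\<close>

text \<open>Summing the hypothesis over \<open>n\<close> equal subintervals divides the cubic error by \<open>n\<^sup>2\<close>.\<close>

lemma lipschitz_if_almost_lipschitz:
  fixes f :: "real \<Rightarrow> real"
  assumes "\<And>t u. t \<in> {a..b} \<Longrightarrow> u \<in> {a..b} \<Longrightarrow> \<bar>f t - f u\<bar> \<le> \<bar>t - u\<bar> + K * \<bar>t - u\<bar> ^ 3"
  shows "1-lipschitz_on {a..b} f"
proof (rule lipschitz_onI)
  fix t u assume t: "t \<in> {a..b}" and u: "u \<in> {a..b}"
  define h where "h = \<bar>t - u\<bar>"
  have bound: "\<bar>f t - f u\<bar> \<le> h + K * h ^ 3 / real (Suc n) ^ 2" for n
  proof -
    define N where "N = real (Suc n)"
    have N: "0 < N" by (simp add: N_def)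
    define x where "x i = u + real i * ((t - u) / N)" for i
    have x_in: "x i \<in> {a..b}" if "i \<le> Suc n" for i
    proof -
      have r: "0 \<le> real i / N" "real i / N \<le> 1" using that N by (auto simp: N_def)
      have "x i = (1 - real i / N) * u + (real i / N) * t" using N by (simp add: x_def field_simps)
      moreover have "convex {a..b}" by simp
      ultimately show ?thesis using r t u convexD[of "{a..b}" u t "1 - real i / N" "real i / N"] by auto
    qed
    have xd: "\<bar>x (Suc i) - x i\<bar> = h / N" for i
    proof -
      have "real (Suc i) * c - real i * c = c" for c by (simp add: distrib_right)
      then have "x (Suc i) - x i = (t - u) / N" by (simp only: x_def add_diff_cancel_left)
      then show ?thesis using N by (simp add: h_def)
    qed
    have "f t - f u = (\<Sum>i<Suc n. f (x (Suc i)) - f (x i))"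
      using N by (subst sum_lessThan_telescope) (simp add: x_def N_def)
    also have "\<bar>\<dots>\<bar> \<le> (\<Sum>i<Suc n. h / N + K * (h / N) ^ 3)"
    proof (rule order_trans[OF sum_abs sum_mono])
      fix i assume "i \<in> {..<Suc n}"
      then show "\<bar>f (x (Suc i)) - f (x i)\<bar> \<le> h / N + K * (h / N) ^ 3"
        using assms[OF x_in x_in, of "Suc i" i] by (simp add: xd)
    qed
    also have "\<dots> = N * (h / N + K * (h / N) ^ 3)" by (simp add: N_def)
    also have "\<dots> = h + K * h ^ 3 / N ^ 2" using N by (simp add: field_simps power2_eq_square power3_eq_cube)
    finally show ?thesis by (simp add: N_def)
  qed
  have "(\<lambda>n. h + K * h ^ 3 / real (Suc n) ^ 2) \<longlonglongrightarrow> h + 0"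
  proof (intro tendsto_intros)
    have "(\<lambda>n. K * h ^ 3 * (inverse (real (Suc n)) ^ 2)) \<longlonglongrightarrow> K * h ^ 3 * 0 ^ 2"
      by (intro tendsto_intros LIMSEQ_inverse_real_of_nat)
    then show "(\<lambda>n. K * h ^ 3 / real (Suc n) ^ 2) \<longlonglongrightarrow> 0"
      by (simp add: divide_inverse power_inverse)
  qed
  then have "\<bar>f t - f u\<bar> \<le> h"
    using LIMSEQ_le_const[of _ "h + 0" "\<bar>f t - f u\<bar>"] bound by auto
  then show "dist (f t) (f u) \<le> 1 * dist t u" by (simp add: dist_real_def h_def)
qed simp

lemma norm_cis_diff: "norm (cis x - cis y) = 2 * \<bar>sin ((x - y) / 2)\<bar>"
proof -
  have "(norm (cis x - cis y))\<^sup>2 = 2 - 2 * cos (x - y)"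
    using sin_cos_squared_add[of x] sin_cos_squared_add[of y]
    unfolding cmod_power2 by (simp add: cos_diff power2_eq_square algebra_simps)
  also have "\<dots> = (2 * \<bar>sin ((x - y) / 2)\<bar>)\<^sup>2"
  proof -
    have "cos (2 * ((x - y) / 2)) = 1 - 2 * (sin ((x - y) / 2))\<^sup>2" by (rule cos_double_sin)
    moreover have "2 * ((x - y) / 2) = x - y" by simp
    ultimately show ?thesis by (simp only: power_mult_distrib power2_abs) simp
  qed
  finally show ?thesis by (rule power2_eq_imp_eq) auto
qed

text \<open>The lower bound for the sine is used twice: with \<open>\<bar>d\<bar> < \<pi>\<close> it yields a bound linear in \<open>h\<close>, and this
  turns its cubic term into one of third order in \<open>h\<close>.\<close>

lemma angle_le_chord:
  assumes "\<bar>d\<bar> < pi" "2 * \<bar>sin (d / 2)\<bar> \<le> h"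
  shows "\<bar>d\<bar> \<le> h + 2 * h ^ 3"
proof -
  define e where "e = \<bar>d\<bar> / 2"
  have e: "0 \<le> e" "e < 2" using assms(1) pi_less_4 by (auto simp: e_def)
  have s: "sin e \<le> h / 2"
    using assms(2) by (cases "d \<ge> 0") (auto simp: e_def)
  have lo: "e - e ^ 3 / 6 \<le> sin e" using e by (intro sin_lower)
  have "e * e \<le> 2 * 2" using e by (intro mult_mono) auto
  then have "e * (e * e) \<le> e * 4" using e by (intro mult_left_mono) auto
  then have "e ^ 3 \<le> 4 * e" by (simp add: power3_eq_cube mult.assoc)
  then have "e \<le> 3 / 2 * h" using lo s by linarith
  then have "e ^ 3 \<le> (3 / 2 * h) ^ 3" using e by (intro power_mono)
  then have "e ^ 3 \<le> 27 / 8 * h ^ 3" by (simp add: power_mult_distrib power_divide)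
  moreover have "0 \<le> h" using \<open>e \<le> 3 / 2 * h\<close> e by linarith
  then have "0 \<le> h ^ 3" by simp
  ultimately have "2 * e \<le> h + 2 * h ^ 3" using lo s by linarith
  then show ?thesis by (simp add: e_def)
qed

text \<open>The unit circle is isometric to the line only infinitesimally: an arc exceeds its chord by a term of
  third order, which \<open>lipschitz_if_almost_lipschitz\<close> removes. For a time at most \<open>1\<close> the
  direction stays in a half plane around \<open>v a\<close>, so the principal argument is a continuous lift.\<close>

lemma steering_angle:
  assumes "steering v a b" "b - a \<le> 1"
  obtains \<theta> where "\<And>t. t \<in> {a..b} \<Longrightarrow> v t = cis (\<theta> t)" "1-lipschitz_on {a..b} \<theta>"
proof -
  define z where "z t = v t / v a" for t
  define \<theta> where "\<theta> t = Arg (v a) + Arg (z t)" for t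
  have ab: "a \<le> b" and nv: "\<And>t. t \<in> {a..b} \<Longrightarrow> norm (v t) = 1"
    and lip: "1-lipschitz_on {a..b} v" using assms(1) unfolding steering_def by auto
  have na: "norm (v a) = 1" using nv ab by auto
  then have va: "v a \<noteq> 0" by auto
  have cis_Arg1: "cis (Arg w) = w" if "norm w = 1" for w
    using rcis_cmod_Arg[of w] that by (simp add: rcis_def)
  have nz: "norm (z t) = 1" if "t \<in> {a..b}" for t using nv[OF that] na by (simp add: z_def norm_divide)
  have v_eq: "v t = cis (\<theta> t)" if "t \<in> {a..b}" for t
    using cis_Arg1[OF na] cis_Arg1[OF nz[OF that]] va by (simp add: \<theta>_def cis_mult[symmetric] z_def)
  have Re_z: "0 < Re (z t)" if "t \<in> {a..b}" for t
  proof -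
    have "norm (v t - v a) \<le> \<bar>t - a\<bar>"
      using lipschitz_onD[OF lip that, of a] ab by (simp add: dist_norm)
    then have "norm (v t - v a) \<le> 1" using that assms(2) by auto
    moreover have "z t - 1 = (v t - v a) / v a" using va by (simp add: z_def diff_divide_distrib)
    ultimately have "norm (z t - 1) \<le> 1" using na by (simp add: norm_divide)
    then have "(norm (z t - 1))\<^sup>2 \<le> 1" by (simp add: power_le_one)
    moreover have "(norm (z t))\<^sup>2 = 1" using nz[OF that] by simp
    ultimately have "2 * Re (z t) \<ge> 1" 
      unfolding cmod_power2 by (simp add: power2_eq_square algebra_simps)
    then show ?thesis by linarith
  qed
  have Arg_z: "\<bar>Arg (z t)\<bar> < pi / 2" if "t \<in> {a..b}" for t
    using arg_conv_arctan[OF Re_z[OF that]] arctan_bounded[of "Im (z t) / Re (z t)"] by auto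
  have "1-lipschitz_on {a..b} \<theta>"
  proof (rule lipschitz_if_almost_lipschitz[where K = 2])
    fix t u assume t: "t \<in> {a..b}" and u: "u \<in> {a..b}"
    show "\<bar>\<theta> t - \<theta> u\<bar> \<le> \<bar>t - u\<bar> + 2 * \<bar>t - u\<bar> ^ 3"
    proof (rule angle_le_chord)
      show "\<bar>\<theta> t - \<theta> u\<bar> < pi" using Arg_z[OF t] Arg_z[OF u] by (simp add: \<theta>_def)
      show "2 * \<bar>sin ((\<theta> t - \<theta> u) / 2)\<bar> \<le> \<bar>t - u\<bar>"
        using lipschitz_onD[OF lip t u] v_eq[OF t] v_eq[OF u] norm_cis_diff[of "\<theta> t" "\<theta> u"]
        by (simp add: dist_norm)
    qed
  qed
  then show ?thesis using v_eq that by blast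
qed

lemma lipschitz_real_bound:
  fixes f :: "real \<Rightarrow> real"
  assumes "1-lipschitz_on S f" "t \<in> S" "u \<in> S"
  shows "\<bar>f t - f u\<bar> \<le> \<bar>t - u\<bar>"
  using lipschitz_onD[OF assms] by (simp add: dist_real_def)

lemma integral_cos_toward:
  fixes x :: real
  assumes "0 \<le> x"
  shows "((\<lambda>t. cos (x - t)) has_integral sin x) {0..x}"
proof -
  have "((\<lambda>t. - sin (x - t)) has_vector_derivative cos (x - t)) (at t within {0..x})" for t
    unfolding has_real_derivative_iff_has_vector_derivative[symmetric]
    by (auto intro!: derivative_eq_intros)
  from fundamental_theorem_of_calculus[OF assms this] show ?thesis by simp
qed

lemma integral_sin_toward:
  fixes x :: real
  assumes "0 \<le> x"
  shows "((\<lambda>t. sin (x - t)) has_integral 1 - cos x) {0..x}"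
proof -
  have "((\<lambda>t. cos (x - t)) has_vector_derivative sin (x - t)) (at t within {0..x})" for t
    unfolding has_real_derivative_iff_has_vector_derivative[symmetric]
    by (auto intro!: derivative_eq_intros)
  from fundamental_theorem_of_calculus[OF assms this] show ?thesis by simp
qed

text \<open>By the Lipschitz condition \<open>f t \<ge> f 0 - t\<close>. The bound is the integral for the function that falls
  to \<open>0\<close> at full speed and stays there, and the sine is increasing on the values in question.\<close>

lemma integral_sin_reaching_zero_ge:
  fixes f :: "real \<Rightarrow> real"
  assumes "0 \<le> r" "r \<le> 1" "1-lipschitz_on {0..r} f" "f r = 0" "\<And>t. t \<in> {0..r} \<Longrightarrow> 0 \<le> f t"
  shows "1 - cos (f 0) \<le> integral {0..r} (\<lambda>t. sin (f t))"
proof -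
  let ?x = "f 0"
  have b: "\<bar>f t - f u\<bar> \<le> \<bar>t - u\<bar>" if "t \<in> {0..r}" "u \<in> {0..r}" for t u
    using lipschitz_real_bound[OF assms(3) that] .
  have x: "0 \<le> ?x" "?x \<le> r" using b[of 0 r] assms by auto
  have cont: "continuous_on {0..r} f" using assms(3) lipschitz_on_continuous_on by blast
  have f1: "0 \<le> f t" "f t \<le> 1" "?x - t \<le> f t" if "t \<in> {0..r}" for t
    using b[OF that, of r] b[OF that, of 0] that assms by auto
  have int: "(\<lambda>t. sin (f t)) integrable_on {c..d}" if "0 \<le> c" "d \<le> r" for c d
    using that by (intro integrable_continuous_interval continuous_intros continuous_on_subset[OF cont]) auto
  have "1 - cos ?x = integral {0..?x} (\<lambda>t. sin (?x - t))"
    using integral_sin_toward[OF x(1)] by (simp add: integral_unique)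
  also have "\<dots> \<le> integral {0..?x} (\<lambda>t. sin (f t))"
  proof (intro integral_le)
    show "(\<lambda>t. sin (?x - t)) integrable_on {0..?x}" using integral_sin_toward[OF x(1)] by blast
    show "(\<lambda>t. sin (f t)) integrable_on {0..?x}" using int x by simp
    fix t assume t: "t \<in> {0..?x}"
    then show "sin (?x - t) \<le> sin (f t)"
      using f1[of t] x pi_ge_two by (intro sin_monotone_2pi_le) auto
  qed
  also have "\<dots> \<le> integral {0..?x} (\<lambda>t. sin (f t)) + integral {?x..r} (\<lambda>t. sin (f t))"
  proof -
    have "0 \<le> integral {?x..r} (\<lambda>t. sin (f t))"
      using x f1 pi_ge_two by (intro integral_nonneg int) (auto intro!: sin_ge_zero intro: order_trans[of _ 1])
    then show ?thesis by simp
  qed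
  also have "\<dots> = integral {0..r} (\<lambda>t. sin (f t))"
    using x int by (intro Henstock_Kurzweil_Integration.integral_combine) auto
  finally show ?thesis .
qed

text \<open>As \<open>f\<close> vanishes at time \<open>r\<close>, \<open>\<bar>f t\<bar> \<le> r - t\<close>, and the cosine is decreasing on the values in question.\<close>

lemma integral_cos_reaching_zero_ge:
  fixes f :: "real \<Rightarrow> real"
  assumes "0 \<le> r" "r \<le> 1" "1-lipschitz_on {0..r} f" "f r = 0"
  shows "sin r \<le> integral {0..r} (\<lambda>t. cos (f t))"
proof -
  have cont: "continuous_on {0..r} f" using assms(3) lipschitz_on_continuous_on by blast
  have "sin r = integral {0..r} (\<lambda>t. cos (r - t))"
    using integral_cos_toward[OF assms(1)] by (simp add: integral_unique)
  also have "\<dots> \<le> integral {0..r} (\<lambda>t. cos (f t))"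
  proof (intro integral_le)
    show "(\<lambda>t. cos (r - t)) integrable_on {0..r}" using integral_cos_toward[OF assms(1)] by blast
    show "(\<lambda>t. cos (f t)) integrable_on {0..r}"
      by (intro integrable_continuous_interval continuous_intros cont)
    fix t assume t: "t \<in> {0..r}"
    then have "\<bar>f t\<bar> \<le> r - t" using lipschitz_real_bound[OF assms(3), of t r] assms by auto
    then have "cos (r - t) \<le> cos \<bar>f t\<bar>"
      using t assms pi_ge_two by (intro cos_monotone_0_pi_le) auto
    then show "cos (r - t) \<le> cos (f t)" by simp
  qed
  finally show ?thesis .
qed

text \<open>By the Lipschitz condition \<open>\<bar>f t\<bar> \<ge> max 0 (\<bar>f 0\<bar> - t)\<close>, and the right side gives the bound. Since the
  integrands are continuous, equality of the integrals forces \<open>f\<close> to head for \<open>0\<close> at full speed and then stay there.\<close>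

lemma integral_cos_reaching_zero_le:
  fixes f :: "real \<Rightarrow> real"
  assumes "0 \<le> r" "r \<le> 1" "1-lipschitz_on {0..r} f" "f r = 0"
  shows "integral {0..r} (\<lambda>t. cos (f t)) \<le> sin \<bar>f 0\<bar> + r - \<bar>f 0\<bar>"
    and "integral {0..r} (\<lambda>t. cos (f t)) = sin \<bar>f 0\<bar> + r - \<bar>f 0\<bar> \<Longrightarrow> t \<in> {0..r} \<Longrightarrow>
         f t = sgn (f 0) * max 0 (\<bar>f 0\<bar> - t)"
proof -
  let ?x = "\<bar>f 0\<bar>" and ?e = "\<lambda>t. cos (max 0 (\<bar>f 0\<bar> - t))"
  have cont: "continuous_on {0..r} f" using assms(3) lipschitz_on_continuous_on by blast
  have b: "\<bar>f t - f u\<bar> \<le> \<bar>t - u\<bar>" if "t \<in> {0..r}" "u \<in> {0..r}" for t u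
    using lipschitz_real_bound[OF assms(3) that] .
  have x: "?x \<le> r" using b[of 0 r] assms by auto
  have le: "max 0 (?x - t) \<le> \<bar>f t\<bar>" "\<bar>f t\<bar> \<le> pi" if "t \<in> {0..r}" for t
    using b[OF that, of 0] b[OF that, of r] that assms pi_ge_two by auto
  have c_le: "cos (f t) \<le> ?e t" if "t \<in> {0..r}" for t
    using cos_monotone_0_pi_le[OF _ le(1)[OF that] le(2)[OF that]] by simp
  have e_int: "?e integrable_on {c..d}" for c d
    by (intro integrable_continuous_interval continuous_intros)
  have f_int: "(\<lambda>t. cos (f t)) integrable_on {0..r}"
    by (intro integrable_continuous_interval continuous_intros cont)
  have "integral {0..r} ?e = integral {0..?x} ?e + integral {?x..r} ?e"
    using x e_int by (intro Henstock_Kurzweil_Integration.integral_combine[symmetric]) auto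
  also have "integral {0..?x} ?e = integral {0..?x} (\<lambda>t. cos (?x - t))"
    by (intro integral_cong) auto
  also have "\<dots> = sin ?x" using integral_cos_toward[of ?x] by (simp add: integral_unique)
  also have "integral {?x..r} ?e = integral {?x..r} (\<lambda>t. 1)"
    by (intro integral_cong) auto
  also have "\<dots> = r - ?x" using x by simp
  finally have e_val: "integral {0..r} ?e = sin ?x + r - ?x" by simp
  show "integral {0..r} (\<lambda>t. cos (f t)) \<le> sin ?x + r - ?x"
    unfolding e_val[symmetric] by (intro integral_le f_int e_int c_le)
  assume eq: "integral {0..r} (\<lambda>t. cos (f t)) = sin ?x + r - ?x" and t: "t \<in> {0..r}"
  have "integral {0..r} (\<lambda>t. ?e t - cos (f t)) = 0"
    using integral_diff[OF e_int f_int] eq e_val by simp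
  moreover have "continuous_on {0..r} (\<lambda>t. ?e t - cos (f t))" by (intro continuous_intros cont)
  moreover have "0 \<le> ?e t - cos (f t)" if "t \<in> {0..r}" for t using c_le[OF that] by simp
  ultimately have "?e t - cos (f t) = 0" if "0 < r"
    using integral_eq_0_iff[of 0 r "\<lambda>t. ?e t - cos (f t)"] that t by blast
  then have "?e t - cos (f t) = 0 \<or> r = 0" using assms(1) by linarith
  then have "\<bar>f t\<bar> = max 0 (?x - t)"
  proof
    assume "?e t - cos (f t) = 0"
    then have "cos (max 0 (?x - t)) = cos \<bar>f t\<bar>" by simp
    then show ?thesis using cos_inj_pi[of "max 0 (?x - t)" "\<bar>f t\<bar>"] le[OF t] by auto
  qed (use t assms in auto)
  then show "f t = sgn (f 0) * max 0 (?x - t)"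
    using b[OF t, of 0] t assms(1) by (auto simp: sgn_if max_def split: if_splits)
qed

section \<open>Short pieces of shortest paths are of type CSC\<close>

text \<open>The displacement, perpendicular to a direction \<open>\<psi>\<close>, of the direct turn between \<open>\<psi> + x\<close>
  and \<open>\<psi>\<close> in either sense of time; it is \<open>sgn x (1 - cos x)\<close>, written so that continuity in \<open>x\<close> is evident.\<close>

definition lateral :: "real \<Rightarrow> real" where
  "lateral x = cos (min x 0) - cos (max x 0)"

lemma integral_backwards:
  fixes f :: "real \<Rightarrow> real"
  assumes "continuous_on {c..T} f"
  shows "integral {0..T - c} (\<lambda>t. f (T - t)) = integral {c..T} f"
  using Henstock_Kurzweil_Integration.integral_reflect_real[of 0 "c - T" "\<lambda>t. f (t + T)"] integral_shift[of "c - T" T 0 f] assms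
  by (simp add: comp_def)

lemma lipschitz_backwards:
  fixes f :: "real \<Rightarrow> real"
  assumes "1-lipschitz_on {0..T} f" "0 \<le> c"
  shows "1-lipschitz_on {0..T - c} (\<lambda>t. f (T - t))"
proof (rule lipschitz_onI)
  fix t u assume "t \<in> {0..T - c}" "u \<in> {0..T - c}"
  then show "dist (f (T - t)) (f (T - u)) \<le> 1 * dist t u"
    using assms(2) lipschitz_real_bound[OF assms(1), of "T - t" "T - u"] by (auto simp: dist_real_def)
qed simp

lemma lipschitz_minus_const:
  fixes f :: "real \<Rightarrow> real"
  assumes "1-lipschitz_on S f" shows "1-lipschitz_on S (\<lambda>t. f t - c)" "1-lipschitz_on S (\<lambda>t. c - f t)"
  using assms by (auto simp: lipschitz_on_def dist_real_def abs_minus_commute)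

text \<open>Direct turns to the maximal angle and back from it deviate from it less than the path does; this
  gives one of the two signs for the intermediate value theorem.\<close>

lemma integral_sin_max:
  fixes \<theta> :: "real \<Rightarrow> real"
  assumes "T \<le> 1" "1-lipschitz_on {0..T} \<theta>" "t1 \<in> {0..T}" "\<And>t. t \<in> {0..T} \<Longrightarrow> \<theta> t \<le> \<theta> t1"
  shows "(1 - cos (\<theta> 0 - \<theta> t1)) + (1 - cos (\<theta> T - \<theta> t1)) \<le> integral {0..T} (\<lambda>t. sin (\<theta> t1 - \<theta> t))"
proof -
  let ?f = "\<lambda>t. \<theta> t1 - \<theta> t"
  have lip: "1-lipschitz_on {0..T} ?f" using assms(2) by (rule lipschitz_minus_const)
  have cont: "continuous_on {0..T} \<theta>" using assms(2) lipschitz_on_continuous_on by blast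
  have 1: "1 - cos (?f 0) \<le> integral {0..t1} (\<lambda>t. sin (?f t))"
    using assms by (intro integral_sin_reaching_zero_ge lipschitz_on_subset[OF lip]) auto
  have "1 - cos (?f (T - 0)) \<le> integral {0..T - t1} (\<lambda>t. sin (?f (T - t)))"
    using assms lipschitz_backwards[OF lip, of t1]
    by (intro integral_sin_reaching_zero_ge[where f = "\<lambda>t. ?f (T - t)"]) auto
  also have "\<dots> = integral {t1..T} (\<lambda>t. sin (?f t))"
    using assms(3) by (intro integral_backwards continuous_intros continuous_on_subset[OF cont]) auto
  finally have 2: "1 - cos (?f T) \<le> integral {t1..T} (\<lambda>t. sin (?f t))" by simp
  have "integral {0..t1} (\<lambda>t. sin (?f t)) + integral {t1..T} (\<lambda>t. sin (?f t)) = integral {0..T} (\<lambda>t. sin (?f t))"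
    using assms(3)
    by (intro Henstock_Kurzweil_Integration.integral_combine integrable_continuous_interval
        continuous_intros cont) auto
  then show ?thesis using 1 2 cos_minus[of "?f 0"] cos_minus[of "?f T"] by simp
qed

definition orient :: "real \<Rightarrow> real" where
  "orient x = (if 0 \<le> x then 1 else - 1)"

lemma orient_simps: "orient x \<in> {-1, 0, 1}" "orient x * \<bar>x\<bar> = x"
  by (auto simp: orient_def)

lemma turn_disp_orient: "turn_disp (orient x) \<bar>x\<bar> = Complex (sin \<bar>x\<bar>) (lateral x)"
  by (auto simp: orient_def turn_disp_def lateral_def)

lemma turn_disp_orient_to: "cis x * turn_disp (- orient x) \<bar>x\<bar> = Complex (sin \<bar>x\<bar>) (lateral x)"
  using turn_disp_backward[of "orient x" "\<bar>x\<bar>"] orient_simps turn_disp_orient by metis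

text \<open>In the frame of \<open>\<psi>\<close> the two components of the displacement separate: the segment affects only
  the one along \<open>\<psi>\<close>.\<close>

lemma disp_CSC:
  "cis (\<psi> + x) * disp [(- orient x, \<bar>x\<bar>), (0, l), (orient y, \<bar>y\<bar>)] =
   cis \<psi> * Complex (sin \<bar>x\<bar> + l + sin \<bar>y\<bar>) (lateral x + lateral y)"
proof -
  have c: "cis (- x) * cis x = 1" by (simp add: cis_mult)
  have o: "- orient x * \<bar>x\<bar> = - x" using orient_simps(2)[of x] by simp
  have "cis (\<psi> + x) * disp [(- orient x, \<bar>x\<bar>), (0, l), (orient y, \<bar>y\<bar>)] =
      cis \<psi> * (cis x * turn_disp (- orient x) \<bar>x\<bar> + (cis (- x) * cis x) * (turn_disp 0 l + turn_disp (orient y) \<bar>y\<bar>))"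
    unfolding disp.simps o by (simp add: cis_mult[symmetric] algebra_simps)
  also have "\<dots> = cis \<psi> * Complex (sin \<bar>x\<bar> + l + sin \<bar>y\<bar>) (lateral x + lateral y)"
    unfolding c turn_disp_orient turn_disp_orient_to turn_disp_straight by (simp add: complex_eq_iff)
  finally show ?thesis .
qed

lemma integral_cis_rotate:
  fixes \<theta> :: "real \<Rightarrow> real"
  assumes "continuous_on {a..b} \<theta>"
  shows "integral {a..b} (\<lambda>t. cis (\<theta> t)) =
    cis \<psi> * Complex (integral {a..b} (\<lambda>t. cos (\<theta> t - \<psi>))) (integral {a..b} (\<lambda>t. sin (\<theta> t - \<psi>)))"
proof -
  have c: "continuous_on {a..b} (\<lambda>t. cis (\<theta> t - \<psi>))"
    by (intro continuous_intros assms)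
  have "integral {a..b} (\<lambda>t. cis (\<theta> t)) = integral {a..b} (\<lambda>t. cis \<psi> * cis (\<theta> t - \<psi>))"
    by (simp add: cis_mult)
  also have "\<dots> = cis \<psi> * integral {a..b} (\<lambda>t. cis (\<theta> t - \<psi>))" by simp
  also have "integral {a..b} (\<lambda>t. cis (\<theta> t - \<psi>)) =
      Complex (integral {a..b} (\<lambda>t. cos (\<theta> t - \<psi>))) (integral {a..b} (\<lambda>t. sin (\<theta> t - \<psi>)))"
    using integral_linear[OF integrable_continuous_interval[OF c] bounded_linear_Re]
      integral_linear[OF integrable_continuous_interval[OF c] bounded_linear_Im]
    by (simp add: complex_eq_iff comp_def)
  finally show ?thesis .
qed

text \<open>Consider the lateral displacement of the path relative to an angle that it attains, minus that of
  the direct turns to and from this angle. The difference is nonpositive for the largest angle and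
  nonnegative for the smallest, so it vanishes for some angle in between.\<close>

lemma balanced_direction:
  fixes \<theta> :: "real \<Rightarrow> real"
  assumes "0 \<le> T" "T \<le> 1" "1-lipschitz_on {0..T} \<theta>"
  obtains t0 where "t0 \<in> {0..T}"
    "integral {0..T} (\<lambda>t. sin (\<theta> t - \<theta> t0)) = lateral (\<theta> 0 - \<theta> t0) + lateral (\<theta> T - \<theta> t0)"
proof -
  define G where "G \<psi> = integral {0..T} (\<lambda>t. sin (\<theta> t - \<psi>)) - lateral (\<theta> 0 - \<psi>) - lateral (\<theta> T - \<psi>)" for \<psi>
  have cont: "continuous_on {0..T} \<theta>" using assms(3) lipschitz_on_continuous_on by blast
  have "integral {0..T} (\<lambda>t. sin (\<theta> t - \<psi>)) =
      cos \<psi> * integral {0..T} (\<lambda>t. sin (\<theta> t)) - sin \<psi> * integral {0..T} (\<lambda>t. cos (\<theta> t))" for \<psi>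
  proof -
    have "integral {0..T} (\<lambda>t. sin (\<theta> t - \<psi>)) = integral {0..T} (\<lambda>t. cos \<psi> * sin (\<theta> t) - sin \<psi> * cos (\<theta> t))"
      by (simp add: sin_diff mult.commute)
    also have "\<dots> = integral {0..T} (\<lambda>t. cos \<psi> * sin (\<theta> t)) - integral {0..T} (\<lambda>t. sin \<psi> * cos (\<theta> t))"
      by (intro integral_diff integrable_continuous_interval continuous_intros cont)
    finally show ?thesis by simp
  qed
  then have G: "continuous_on UNIV G"
    unfolding G_def[abs_def] lateral_def by (auto intro!: continuous_intros)
  obtain t1 where t1: "t1 \<in> {0..T}" "\<And>t. t \<in> {0..T} \<Longrightarrow> \<theta> t \<le> \<theta> t1"
    using continuous_attains_sup[of "{0..T}" \<theta>] cont assms(1) by auto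
  obtain t2 where t2: "t2 \<in> {0..T}" "\<And>t. t \<in> {0..T} \<Longrightarrow> \<theta> t2 \<le> \<theta> t"
    using continuous_attains_inf[of "{0..T}" \<theta>] cont assms(1) by auto
  have "G (\<theta> t1) \<le> 0"
  proof -
    have "integral {0..T} (\<lambda>t. sin (\<theta> t - \<theta> t1)) = integral {0..T} (\<lambda>t. - sin (\<theta> t1 - \<theta> t))"
      by (simp flip: sin_minus)
    moreover have "lateral (\<theta> 0 - \<theta> t1) = - (1 - cos (\<theta> 0 - \<theta> t1))" "lateral (\<theta> T - \<theta> t1) = - (1 - cos (\<theta> T - \<theta> t1))"
      using t1(2)[of 0] t1(2)[of T] assms(1) by (simp_all add: lateral_def)
    ultimately show ?thesis
      using integral_sin_max[OF assms(2,3) t1] unfolding G_def by simp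
  qed
  moreover have "0 \<le> G (\<theta> t2)"
  proof -
    have "1-lipschitz_on {0..T} (\<lambda>t. - \<theta> t)" using lipschitz_minus_const(2)[OF assms(3), of 0] by simp
    from integral_sin_max[OF assms(2) this t2(1)] t2(2)
    have "1 - cos (- \<theta> 0 + \<theta> t2) + (1 - cos (- \<theta> T + \<theta> t2)) \<le> integral {0..T} (\<lambda>t. sin (\<theta> t - \<theta> t2))"
      by simp
    moreover have "cos (- \<theta> 0 + \<theta> t2) = cos (\<theta> 0 - \<theta> t2)" "cos (- \<theta> T + \<theta> t2) = cos (\<theta> T - \<theta> t2)"
      using cos_minus[of "\<theta> 0 - \<theta> t2"] cos_minus[of "\<theta> T - \<theta> t2"] by simp_all
    moreover have "lateral (\<theta> 0 - \<theta> t2) = 1 - cos (\<theta> 0 - \<theta> t2)" "lateral (\<theta> T - \<theta> t2) = 1 - cos (\<theta> T - \<theta> t2)"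
      using t2(2)[of 0] t2(2)[of T] assms(1) by (simp_all add: lateral_def)
    ultimately show ?thesis unfolding G_def by simp
  qed
  moreover have "connected ((\<lambda>t. G (\<theta> t)) ` {0..T})"
    by (intro connected_continuous_image continuous_on_compose2[OF G cont]) auto
  ultimately have "0 \<in> (\<lambda>t. G (\<theta> t)) ` {0..T}"
    using connectedD_interval[of "(\<lambda>t. G (\<theta> t)) ` {0..T}" "G (\<theta> t1)" "G (\<theta> t2)" 0] t1(1) t2(1) by auto
  then obtain t0 where "t0 \<in> {0..T}" "G (\<theta> t0) = 0" by auto
  then show ?thesis using that unfolding G_def by simp
qed

text \<open>In the balanced direction \<open>\<psi> = \<theta> t0\<close> the CSC program with the right displacement has a segment of
  nonnegative length (lower bound on the cosine integrals) and is at most as long as the path (upper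
  bound). As the path is shortest, the upper bound is attained on both sides of \<open>t0\<close>, which determines \<open>\<theta>\<close>.\<close>

lemma local_structure_from_0:
  assumes sh: "shortest v 0 T" and T: "0 < T" "T \<le> 1"
  obtains c d k1 k2 where "0 \<le> c" "c \<le> d" "d \<le> T" "k1 \<in> {-1, 1}" "k2 \<in> {-1, 1}"
    "along v k1 0 c" "along v 0 c d" "along v k2 d T"
proof -
  obtain \<theta> where v: "\<And>t. t \<in> {0..T} \<Longrightarrow> v t = cis (\<theta> t)" and lip: "1-lipschitz_on {0..T} \<theta>"
    using steering_angle[OF shortest_imp_steering[OF sh]] T by auto
  have cont: "continuous_on {0..T} \<theta>" using lip lipschitz_on_continuous_on by blast
  obtain t0 where t0: "t0 \<in> {0..T}" and
    bal: "integral {0..T} (\<lambda>t. sin (\<theta> t - \<theta> t0)) = lateral (\<theta> 0 - \<theta> t0) + lateral (\<theta> T - \<theta> t0)"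
    using balanced_direction[OF _ T(2) lip] T(1) by auto
  define \<psi> x y where "\<psi> = \<theta> t0" "x = \<theta> 0 - \<psi>" "y = \<theta> T - \<psi>"
  note d = this
  let ?f = "\<lambda>t. \<theta> t - \<psi>"
  let ?C = "integral {0..T} (\<lambda>t. cos (?f t))"
  let ?C1 = "integral {0..t0} (\<lambda>t. cos (?f t))"
  let ?C2 = "integral {0..T - t0} (\<lambda>t. cos (?f (T - t)))"
  have lipf: "1-lipschitz_on {0..T} ?f" using lip by (rule lipschitz_minus_const)
  have xb: "\<bar>x\<bar> \<le> t0" and yb: "\<bar>y\<bar> \<le> T - t0"
    using lipschitz_real_bound[OF lip, of 0 t0] lipschitz_real_bound[OF lip, of T t0] t0 by (auto simp: d)
  have C: "?C = ?C1 + ?C2"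
  proof -
    have "?C1 + integral {t0..T} (\<lambda>t. cos (?f t)) = ?C"
      using t0 by (intro Henstock_Kurzweil_Integration.integral_combine
          integrable_continuous_interval continuous_intros cont) auto
    moreover have "?C2 = integral {t0..T} (\<lambda>t. cos (?f t))"
      using t0 by (intro integral_backwards continuous_intros continuous_on_subset[OF cont]) auto
    ultimately show ?thesis by simp
  qed
  have h1: "0 \<le> t0" "t0 \<le> 1" "1-lipschitz_on {0..t0} ?f" "?f t0 = 0"
    using t0 T by (auto intro!: lipschitz_on_subset[OF lipf[unfolded d]] simp: d)
  have h2: "0 \<le> T - t0" "T - t0 \<le> 1" "1-lipschitz_on {0..T - t0} (\<lambda>t. ?f (T - t))" "?f (T - (T - t0)) = 0"
    using t0 T lipschitz_backwards[OF lipf] by (auto simp: d)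
  note lo1 = integral_cos_reaching_zero_ge[OF h1] and lo2 = integral_cos_reaching_zero_ge[OF h2]
  note up1 = integral_cos_reaching_zero_le(1)[OF h1] and up2 = integral_cos_reaching_zero_le(1)[OF h2]
  have fx: "?f 0 = x" and fy: "?f (T - 0) = y" by (simp_all add: d)
  define l where "l = ?C - sin \<bar>x\<bar> - sin \<bar>y\<bar>"
  have "sin \<bar>x\<bar> \<le> sin t0" "sin \<bar>y\<bar> \<le> sin (T - t0)"
    using xb yb t0 T pi_ge_two by (intro sin_monotone_2pi_le; simp)+
  then have l0: "0 \<le> l" using lo1 lo2 C by (simp add: l_def)
  let ?ps = "[(- orient x, \<bar>x\<bar>), (0, l), (orient y, \<bar>y\<bar>)]"
  have "integral {0..T} v = v 0 * disp ?ps"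
  proof -
    have "integral {0..T} v = integral {0..T} (\<lambda>t. cis (\<theta> t))"
      by (intro integral_cong v)
    also have "\<dots> = cis \<psi> * Complex ?C (lateral x + lateral y)"
      using integral_cis_rotate[OF cont, of \<psi>] bal by (simp add: d)
    also have "\<dots> = cis (\<psi> + x) * disp ?ps"
      unfolding disp_CSC by (simp add: l_def)
    also have "cis (\<psi> + x) = v 0" using v[of 0] T by (simp add: d)
    finally show ?thesis .
  qed
  moreover have "v T = v 0 * cis (turn ?ps)"
    using v[of T] v[of 0] T orient_simps(2)[of x] orient_simps(2)[of y] by (simp add: cis_mult d)
  moreover have "valid ?ps" using l0 orient_simps(1) by (auto simp: orient_def)
  moreover have "0 < len ?ps"
  proof (rule ccontr)
    assume "\<not> 0 < len ?ps"
    then have "\<bar>x\<bar> = 0" "\<bar>y\<bar> = 0" "l = 0" using l0 by auto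
    then have "?C \<le> 0" by (simp add: l_def)
    then have "sin t0 + sin (T - t0) \<le> 0" using lo1 lo2 C by simp
    moreover have "0 \<le> sin t0" "0 \<le> sin (T - t0)"
      using t0 T pi_ge_two by (auto intro!: sin_ge_zero)
    moreover have "0 < sin t0 \<or> 0 < sin (T - t0)"
      using t0 T pi_ge_two by (cases "0 < t0") (auto intro!: sin_gt_zero)
    ultimately show False by linarith
  qed
  ultimately have "T - 0 \<le> len ?ps" by (intro shortestD[OF sh])
  then have "T \<le> \<bar>x\<bar> + \<bar>y\<bar> + ?C - sin \<bar>x\<bar> - sin \<bar>y\<bar>" by (simp add: l_def)
  \<comment> \<open>The bounds on the two sides of \<open>t0\<close> add up to exactly what minimality demands, so both are attained.\<close>
  then have eq1: "?C1 = sin \<bar>x\<bar> + t0 - \<bar>x\<bar>" and eq2: "?C2 = sin \<bar>y\<bar> + (T - t0) - \<bar>y\<bar>"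
    using up1 up2 C unfolding fx fy by linarith+
  have f1: "\<theta> t = \<psi> + sgn x * max 0 (\<bar>x\<bar> - t)" if "t \<in> {0..t0}" for t
    using integral_cos_reaching_zero_le(2)[OF h1 _ that] eq1 unfolding fx by (simp add: algebra_simps)
  have f2: "\<theta> t = \<psi> + sgn y * max 0 (\<bar>y\<bar> - (T - t))" if "t \<in> {t0..T}" for t
    using integral_cos_reaching_zero_le(2)[OF h2, of "T - t"] eq2 that unfolding fy by (simp add: algebra_simps)
  have mid: "\<theta> t = \<psi>" if "\<bar>x\<bar> \<le> t" "t \<le> T - \<bar>y\<bar>" for t
    using f1[of t] f2[of t] that t0 yb by (cases "t \<le> t0") (auto simp: max_def)
  show ?thesis
  proof (rule that[of "\<bar>x\<bar>" "T - \<bar>y\<bar>" "- orient x" "orient y"])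
    show "along v (- orient x) 0 \<bar>x\<bar>"
    proof (rule alongI)
      fix t assume t: "0 \<le> t" "t \<le> \<bar>x\<bar>"
      have "\<theta> t = \<theta> 0 + - orient x * (t - 0)"
        using f1[of t] f1[of 0] t t0 xb by (auto simp: orient_def sgn_if split: if_splits)
      then show "v t = v 0 * cis (- orient x * (t - 0))"
        using v[of t] v[of 0] t t0 xb by (simp add: cis_mult)
    qed
    show "along v 0 \<bar>x\<bar> (T - \<bar>y\<bar>)"
    proof (rule alongI)
      fix t assume t: "\<bar>x\<bar> \<le> t" "t \<le> T - \<bar>y\<bar>"
      have "0 \<le> t" "t \<le> T" "\<bar>x\<bar> \<le> T" using t xb yb t0 by auto
      then show "v t = v \<bar>x\<bar> * cis (0 * (t - \<bar>x\<bar>))"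
        using mid[of t] mid[of "\<bar>x\<bar>"] v[of t] v[of "\<bar>x\<bar>"] t xb yb by simp
    qed
    show "along v (orient y) (T - \<bar>y\<bar>) T"
    proof (rule alongI)
      fix t assume t: "T - \<bar>y\<bar> \<le> t" "t \<le> T"
      have "\<theta> t = \<theta> (T - \<bar>y\<bar>) + orient y * (t - (T - \<bar>y\<bar>))"
        using f2[of t] f2[of "T - \<bar>y\<bar>"] t t0 yb by (auto simp: orient_def sgn_if split: if_splits)
      then show "v t = v (T - \<bar>y\<bar>) * cis (orient y * (t - (T - \<bar>y\<bar>)))"
        using v[of t] v[of "T - \<bar>y\<bar>"] t t0 yb by (simp add: cis_mult)
    qed
  qed (use xb yb in \<open>auto simp: orient_def\<close>)
qed

lemma local_structure:
  assumes sh: "shortest v a b" and "a < b" "b - a \<le> 1"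
  obtains c d k1 k2 where "a \<le> c" "c \<le> d" "d \<le> b" "k1 \<in> {-1, 1}" "k2 \<in> {-1, 1}"
    "along v k1 a c" "along v 0 c d" "along v k2 d b"
proof -
  have "0 < b - a" using assms(2) by simp
  obtain c d k1 k2 where "0 \<le> c" "c \<le> d" "d \<le> b - a" "k1 \<in> {-1, 1}" "k2 \<in> {-1, 1}"
    "along (\<lambda>t. v (t + a)) k1 0 c" "along (\<lambda>t. v (t + a)) 0 c d" "along (\<lambda>t. v (t + a)) k2 d (b - a)"
    by (rule local_structure_from_0[OF shortest_shift[OF sh] \<open>0 < b - a\<close> assms(3)])
  then show ?thesis
    using along_shift[of v a] by (intro that[of "c + a" "d + a" k1 k2]) force+
qed

section \<open>Sequences of maximal pieces\<close>

lemma along_maximal: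
  assumes sh: "shortest v a b" and "along v k a e" "a \<le> e" "e \<le> b"
  obtains m where "e \<le> m" "m \<le> b" "along v k a m" "\<And>m'. m < m' \<Longrightarrow> m' \<le> b \<Longrightarrow> \<not> along v k a m'"
proof -
  define S where "S = {m \<in> {a..b}. along v k a m}"
  have cont: "continuous_on {a..b} v" using steering_continuous[OF shortest_imp_steering[OF sh]] .
  have eS: "e \<in> S" using assms by (simp add: S_def)
  have bdd: "bdd_above S" by (auto simp: S_def bdd_above_def)
  define m where "m = Sup S"
  have em: "e \<le> m" unfolding m_def using eS bdd by (rule cSup_upper)
  have mb: "m \<le> b" unfolding m_def using eS by (intro cSup_least) (auto simp: S_def)
  have below: "v t = v a * cis (k * (t - a))" if t: "a \<le> t" "t < m" for t
  proof -
    obtain u where "u \<in> S" "t < u"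
      using less_cSup_iff[of S t] t eS bdd unfolding m_def by blast
    then show ?thesis using alongD[of v k a u t] t by (auto simp: S_def)
  qed
  have "v m = v a * cis (k * (m - a))"
  proof (cases "a = m")
    case True then show ?thesis by simp
  next
    case False
    then have am: "a < m" using assms em by simp
    have "continuous_on {a..m} v" using cont by (rule continuous_on_subset) (use mb in auto)
    then have 1: "(v \<longlongrightarrow> v m) (at m within {a..m})" using am by (auto simp: continuous_on_def)
    have "((\<lambda>t. v a * cis (k * (t - a))) \<longlongrightarrow> v a * cis (k * (m - a))) (at m within {a..m})"
      by (intro tendsto_intros)
    then have 2: "(v \<longlongrightarrow> v a * cis (k * (m - a))) (at m within {a..m})"
    proof (rule Lim_transform_eventually)
      show "\<forall>\<^sub>F t in at m within {a..m}. v a * cis (k * (t - a)) = v t"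
        unfolding eventually_at_filter
        by (intro always_eventually allI impI below[symmetric]) simp_all
    qed
    have "at m within {a..m} \<noteq> bot" using am by (simp add: at_within_Icc_at_left)
    then show ?thesis using tendsto_unique[OF _ 1 2] by blast
  qed
  then have "v t = v a * cis (k * (t - a))" if "a \<le> t" "t \<le> m" for t
    by (cases "t = m") (use that in \<open>auto intro: below\<close>)
  then have al: "along v k a m" by (rule alongI)
  have "\<not> along v k a m'" if "m < m'" "m' \<le> b" for m'
  proof
    assume "along v k a m'"
    then have "m' \<in> S" using that em assms(3) by (simp add: S_def)
    then have "m' \<le> m" unfolding m_def using bdd by (rule cSup_upper)
    then show False using that by simp
  qed
  then show ?thesis using that em mb al by blast
qed

text \<open>The first piece of positive length in the local structure.\<close>

lemma shortest_starts_along: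
  assumes "shortest v a b" "a < b" "\<And>c d. a \<le> c \<Longrightarrow> c \<le> d \<Longrightarrow> d \<le> b \<Longrightarrow> shortest v c d"
  obtains k e where "k \<in> {-1, 0, 1}" "a < e" "e \<le> b" "along v k a e"
proof -
  \<comment> \<open>The local structure is available for times up to \<open>1\<close>.\<close>
  define b' where "b' = min b (a + 1)"
  have b': "a < b'" "b' \<le> b" "b' - a \<le> 1" using assms(2) by (auto simp: b'_def)
  obtain c d k1 k2 where cd: "a \<le> c" "c \<le> d" "d \<le> b'" "k1 \<in> {-1, 1}" "k2 \<in> {-1, 1}"
    "along v k1 a c" "along v 0 c d" "along v k2 d b'"
    by (rule local_structure[OF assms(3)[OF order_refl less_imp_le[OF b'(1)] b'(2)] b'(1,3)])
  consider "a < c" | "a = c" "c < d" | "a = c" "c = d" using cd by linarith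
  then show ?thesis
  proof cases
    case 1 then show ?thesis using cd b' by (intro that[of k1 c]) auto
  next
    case 2 then show ?thesis using cd b' by (intro that[of 0 d]) auto
  next
    case 3 then show ?thesis using cd b' by (intro that[of k2 b']) auto
  qed
qed

text \<open>A shortest path of length \<open>s\<close>, through the property that all its parts are shortest as well.\<close>

locale shortest_direction =
  fixes v :: "real \<Rightarrow> complex" and s :: real
  assumes s_pos: "0 < s"
    and shortest_sub: "\<And>a b. 0 \<le> a \<Longrightarrow> a \<le> b \<Longrightarrow> b \<le> s \<Longrightarrow> shortest v a b"
begin

text \<open>Maximality is required to the right only, because pieces are read off from the start of the path.\<close>

definition piece :: "real \<Rightarrow> real \<Rightarrow> real \<Rightarrow> bool" where
  "piece k a m \<longleftrightarrow> k \<in> {-1, 0, 1} \<and> 0 \<le> a \<and> a < m \<and> m \<le> s \<and> along v k a m \<and>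
     (\<forall>m'. m < m' \<and> m' \<le> s \<longrightarrow> \<not> along v k a m')"

lemma piece_exists:
  assumes "0 \<le> a" "a < s"
  shows "\<exists>k m. piece k a m"
proof -
  have sh: "shortest v a s" using assms by (intro shortest_sub) auto
  obtain k e where ke: "k \<in> {-1, 0, 1}" "a < e" "e \<le> s" "along v k a e"
    by (rule shortest_starts_along[OF sh assms(2) shortest_sub[OF order_trans[OF assms(1)]]]) blast+
  obtain m where "e \<le> m" "m \<le> s" "along v k a m" "\<And>m'. m < m' \<Longrightarrow> m' \<le> s \<Longrightarrow> \<not> along v k a m'"
    by (rule along_maximal[OF sh ke(4) less_imp_le[OF ke(2)] ke(3)]) blast
  then show ?thesis using ke assms by (intro exI[of _ k] exI[of _ m]) (auto simp: piece_def)
qed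

lemma next_piece:
  assumes "piece k a m"
  shows "m = s \<or> (\<exists>k' m'. k' \<noteq> k \<and> piece k' m m')"
proof (rule disjCI)
  assume "\<not> (\<exists>k' m'. k' \<noteq> k \<and> piece k' m m')"
  then have no: "\<And>k' m'. piece k' m m' \<Longrightarrow> k' = k" by blast
  show "m = s"
  proof (rule ccontr)
    assume "m \<noteq> s"
    then obtain k' m' where p: "piece k' m m'"
      using piece_exists[of m] assms unfolding piece_def by auto
    then have "along v k a m'" using assms no[OF p] along_join[of v k a m m'] unfolding piece_def by auto
    then show False using assms p unfolding piece_def by blast
  qed
qed

lemma not_shortenable:
  assumes "valid ps" "follows v a ps" "0 \<le> a" "a + len ps \<le> s"
  shows "\<not> shortenable ps"
  using not_shortest_if_shortenable[OF assms(1,2)] shortest_sub[of a "a + len ps"] valid_len[OF assms(1)] assms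
  by auto

lemma arc_length:
  assumes "k \<in> {-1, 1}" "along v k a b" "0 \<le> a" "a \<le> b" "b \<le> s"
  shows "b - a \<le> 2 * pi"
  using arc_le_2pi[OF shortest_sub assms(2,1)] assms by auto

text \<open>A full circle followed by something of positive length can be deleted, since what remains still has
  positive length.\<close>

lemma arc_length_less:
  assumes k: "k \<in> {-1, 1}" and al: "along v k a b" and ab: "0 \<le> a" "a \<le> b" "b < s"
  shows "b - a < 2 * pi"
proof (rule ccontr)
  assume "\<not> b - a < 2 * pi"
  then have eq: "b = a + 2 * pi" using arc_length[OF k al] ab by auto
  obtain k' m where m: "piece k' b m" using piece_exists[of b] ab by auto
  have "valid [(k, 2 * pi), (k', m - b)]" "follows v a [(k, 2 * pi), (k', m - b)]"
    using k m al unfolding piece_def eq by auto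
  then have "\<not> shortenable [(k, 2 * pi), (k', m - b)]"
    using m ab unfolding piece_def by (intro not_shortenable) (auto simp: eq)
  moreover have "shortenable [(k, 2 * pi), (k', m - b)]"
    unfolding shortenable_def using m k
    by (intro exI[of _ "[(k', m - b)]"])
       (auto simp: piece_def turn_disp_def complex_eq_iff cos_add sin_add cos_diff sin_diff)
  ultimately show False by simp
qed

lemma consecutive_three:
  assumes "piece k1 a b" "piece k2 b c" "piece k3 c d"
  shows "\<not> shortenable [(k1, b - a), (k2, c - b), (k3, d - c)]"
  using assms by (intro not_shortenable[of _ a]) (auto simp: piece_def)

lemma consecutive_four:
  assumes "piece k1 a b" "piece k2 b c" "piece k3 c d" "piece k4 d e"
  shows "\<not> shortenable [(k1, b - a), (k2, c - b), (k3, d - c), (k4, e - d)]"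
  using assms by (intro not_shortenable[of _ a]) (auto simp: piece_def)

lemma middle_length:
  assumes "piece k2 b c" "piece k3 c d" "k2 \<in> {-1, 1}"
  shows "0 < c - b" "c - b < 2 * pi"
  using assms arc_length_less[of k2 b c] by (auto simp: piece_def)

lemma no_SCX:
  assumes p: "piece 0 a b" "piece k2 b c" "piece k3 c d" and "k2 \<noteq> 0" "k3 \<noteq> k2"
  shows False
proof -
  have k2: "k2 \<in> {-1, 1}" using p assms(4) by (auto simp: piece_def)
  have pos: "0 < b - a" "0 < d - c" using p by (auto simp: piece_def)
  note mid = middle_length[OF p(2,3) k2]
  note no = consecutive_three[OF p]
  have SLS: "shortenable [(0, b - a), (1, c - b), (0, d - c)]"
    and SLR: "shortenable [(0, b - a), (1, c - b), (-1, d - c)]"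
    using pos mid by (auto intro: shortenable_SLS shortenable_SLR)
  have "k3 = 0 \<or> k3 = - k2" using assms k2 p(3) by (auto simp: piece_def)
  then show False
    using k2 no SLS SLR shortenable_mirror[OF SLS] shortenable_mirror[OF SLR] by auto
qed

text \<open>Reversal turns this into an instance of SCC.\<close>

lemma no_CCS:
  assumes p: "piece k1 a b" "piece k2 b c" "piece 0 c d" and "k1 \<noteq> 0" "k2 \<noteq> 0" "k1 \<noteq> k2"
  shows False
proof -
  have k2: "k2 \<in> {-1, 1}" "k1 = - k2" using p assms(4-6) by (auto simp: piece_def)
  have pos: "0 < b - a" "0 < d - c" using p by (auto simp: piece_def)
  note mid = middle_length[OF p(2,3) k2(1)]
  have SLR: "shortenable [(0, d - c), (1, c - b), (-1, b - a)]"
    using pos mid by (auto intro: shortenable_SLR)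
  have bw: "shortenable [(1, b - a), (-1, c - b), (0, d - c)]"
    using shortenable_backward[OF _ SLR] pos mid by simp
  show False
    using k2 consecutive_three[OF p] bw shortenable_mirror[OF bw] by auto
qed

lemma CCC_middle:
  assumes p: "piece k1 a b" "piece k2 b c" "piece k3 c d"
    and "k1 \<in> {-1, 1}" "k2 = - k1" "k3 = k1"
  shows "pi < c - b"
proof (rule ccontr)
  assume "\<not> pi < c - b"
  then have RLR: "shortenable [(-1, b - a), (1, c - b), (-1, d - c)]"
    using p by (intro shortenable_RLR) (auto simp: piece_def)
  then show False
    using consecutive_three[OF p] shortenable_mirror[OF RLR] assms(4-6) by auto
qed

lemma no_CCCC:
  assumes p: "piece k1 a b" "piece k2 b c" "piece k3 c d" "piece k4 d e"
    and "k1 \<in> {-1, 1}" "k2 = - k1" "k3 = k1" "k4 = - k1"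
  shows False
proof -
  have "pi < c - b" "pi < d - c" using CCC_middle[of k1 a b k2 c k3 d] CCC_middle[of k2 b c k3 d k4 e] assms by auto
  moreover have "c - b < 2 * pi" "d - c < 2 * pi"
    using middle_length[OF p(2,3)] middle_length[OF p(3,4)] assms by auto
  ultimately have RLRL: "shortenable [(-1, b - a), (1, c - b), (-1, d - c), (1, e - d)]"
    using p by (intro shortenable_RLRL) (auto simp: piece_def)
  then show False
    using consecutive_four[OF p] shortenable_mirror[OF RLRL] assms(5-8) by auto
qed

text \<open>Following the maximal pieces from the start: once a segment has occurred, one arc can follow and
  nothing else; two consecutive arcs cannot be followed by a segment, three not by a
  fourth arc. Missing pieces are supplied with length zero.\<close>

lemma CSC_or_CCC:
  obtains (CSC) k1 k3 c d where "k1 \<in> {-1, 1}" "k3 \<in> {-1, 1}" "0 \<le> c" "c \<le> d" "d \<le> s"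
      "along v k1 0 c" "along v 0 c d" "along v k3 d s"
    | (CCC) k c d where "k \<in> {-1, 1}" "0 \<le> c" "c \<le> d" "d \<le> s" "pi < d - c"
      "along v k 0 c" "along v (- k) c d" "along v k d s"
proof -
  obtain k1 b where p1: "piece k1 0 b" using piece_exists[of 0] s_pos by auto
  show ?thesis
  proof (cases "k1 = 0")
    case True
    show ?thesis
    proof (cases "b = s")
      case b: True
      then show ?thesis using p1 True
        by (intro CSC[of 1 1 0 s]) (auto simp: piece_def along_trivial)
    next
      case False
      then obtain k2 c where p2: "k2 \<noteq> k1" "piece k2 b c" using next_piece[OF p1] by auto
      have "c = s" using next_piece[OF p2(2)] no_SCX[of 0 b k2 c] p1 p2 True by metis
      then show ?thesis using p1 p2 True
        by (intro CSC[of 1 k2 0 b]) (auto simp: piece_def along_trivial)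
    qed
  next
    case k1: False
    then have k1': "k1 \<in> {-1, 1}" using p1 by (auto simp: piece_def)
    show ?thesis
    proof (cases "b = s")
      case True
      then show ?thesis using p1 k1'
        by (intro CSC[of k1 1 s s]) (auto simp: piece_def along_trivial)
    next
      case False
      then obtain k2 c where p2: "k2 \<noteq> k1" "piece k2 b c" using next_piece[OF p1] by auto
      show ?thesis
      proof (cases "c = s")
        case True
        show ?thesis
        proof (cases "k2 = 0")
          case k2: True
          then show ?thesis using p1 p2 k1' True
            by (intro CSC[of k1 1 b s]) (auto simp: piece_def along_trivial)
        next
          case k2: False
          then show ?thesis using p1 p2 k1' True
            by (intro CSC[of k1 k2 b b]) (auto simp: piece_def along_trivial)
        qed
      next
        case False
        then obtain k3 d where p3: "k3 \<noteq> k2" "piece k3 c d" using next_piece[OF p2(2)] by auto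
        show ?thesis
        proof (cases "k2 = 0")
          case True
          have "d = s" using next_piece[OF p3(2)] no_SCX[of b c k3 d] p2 p3 True by metis
          then show ?thesis using p1 p2 p3 k1' True
            by (intro CSC[of k1 k3 b c]) (auto simp: piece_def)
        next
          case k2: False
          then have k2': "k2 = - k1" using p2 k1' by (auto simp: piece_def)
          have "k3 \<noteq> 0" using no_CCS[OF p1 p2(2)] p2 p3 k1 k2 by auto
          then have k3': "k3 = k1" using p3 k2' k1' by (auto simp: piece_def)
          have "d = s"
          proof (rule ccontr)
            assume "d \<noteq> s"
            then obtain k4 e where p4: "k4 \<noteq> k3" "piece k4 d e" using next_piece[OF p3(2)] by auto
            have "k4 \<noteq> 0" using no_CCS[OF p2(2) p3(2)] p3 p4 k1 k2 k3' by auto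
            then have "k4 = - k1" using p4 k3' k1' by (auto simp: piece_def)
            then show False using no_CCCC[OF p1 p2(2) p3(2) p4(2)] k1' k2' k3' by auto
          qed
          then show ?thesis using p1 p2 p3 k1' k2' k3' CCC_middle[OF p1 p2(2) p3(2)]
            by (intro CCC[of k1 b c]) (auto simp: piece_def)
        qed
      qed
    qed
  qed
qed

end

section \<open>Paths in the plane\<close>

definition to_complex :: "plane \<Rightarrow> complex" where
  "to_complex p = Complex (p $ 1) (p $ 2)"

definition to_plane :: "complex \<Rightarrow> plane" where
  "to_plane z = vector [Re z, Im z]"

lemma to_complex_to_plane [simp]: "to_complex (to_plane z) = z"
  by (simp add: to_complex_def to_plane_def)

lemma to_plane_to_complex [simp]: "to_plane (to_complex p) = p"
  by (simp add: to_complex_def to_plane_def vec_eq_iff forall_2)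

lemma norm_to_complex [simp]: "norm (to_complex p) = norm p"
  by (simp add: to_complex_def complex_norm norm_vec_def L2_set_def sum_2)

lemma norm_to_plane [simp]: "norm (to_plane z) = norm z"
  using norm_to_complex[of "to_plane z"] by simp

lemma bounded_linear_to_complex: "bounded_linear to_complex"
proof (rule bounded_linear_intro[of _ 1])
  show "norm (to_complex p) \<le> norm p * 1" for p by simp
qed (simp_all add: to_complex_def complex_eq_iff)

lemma bounded_linear_to_plane: "bounded_linear to_plane"
proof (rule bounded_linear_intro[of _ 1])
  show "norm (to_plane z) \<le> norm z * 1" for z by simp
qed (simp_all add: to_plane_def vec_eq_iff forall_2)

lemma to_plane_diff: "to_plane (z - w) = to_plane z - to_plane w"
  and to_plane_add: "to_plane (z + w) = to_plane z + to_plane w"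
  and to_plane_scaleR: "to_plane (c *\<^sub>R z) = c *\<^sub>R to_plane z"
  by (simp_all add: to_plane_def vec_eq_iff forall_2)

lemma to_complex_inject: "to_complex p = to_complex q \<Longrightarrow> p = q"
  by (metis to_plane_to_complex)

lemma circle_point_to_complex: "to_complex (circle_point c \<theta>) = to_complex c + cis \<theta>"
  by (simp add: circle_point_def to_complex_def complex_eq_iff)

lemma velocity_eq:
  assumes "0 < snd \<gamma>" "t \<in> {0..snd \<gamma>}" "(fst \<gamma> has_vector_derivative w) (at t within {0..snd \<gamma>})"
  shows "velocity \<gamma> t = w"
  unfolding velocity_def using assms by (intro vector_derivative_within_closed_interval) auto

text \<open>In the interior of a \<open>C\<^sup>2\<close> piece the second derivative is the derivative of the velocity within the
  whole interval, so the curvature condition bounds it there, and by continuity also at the ends of the piece.\<close>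

lemma steering_on_piece:
  assumes C2: "C2_on_interval (fst \<gamma>) a b" and ab: "0 \<le> a" "a < b" "b \<le> snd \<gamma>"
    and C1: "C1_path \<gamma>" and unit: "\<forall>t\<in>{0..snd \<gamma>}. norm (velocity \<gamma> t) = 1"
    and curv: "\<forall>t\<in>{0..snd \<gamma>}. \<forall>A. (velocity \<gamma> has_vector_derivative A) (at t within {0..snd \<gamma>}) \<longrightarrow> norm A \<le> 1"
  shows "steering (\<lambda>t. to_complex (velocity \<gamma> t)) a b"
proof -
  let ?w = "velocity \<gamma>"
  obtain g1 g2 where g1: "\<forall>t\<in>{a..b}. (fst \<gamma> has_vector_derivative g1 t) (at t within {a..b})"
    and g2: "\<forall>t\<in>{a..b}. (g1 has_vector_derivative g2 t) (at t within {a..b})" "continuous_on {a..b} g2"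
    using C2 unfolding C2_on_interval_def by blast
  have sub: "{a..b} \<subseteq> {0..snd \<gamma>}" using ab by auto
  have w_g1: "?w t = g1 t" if "t \<in> {a..b}" for t
  proof -
    have "(fst \<gamma> has_vector_derivative ?w t) (at t within {0..snd \<gamma>})"
      using C1 sub that unfolding C1_path_def velocity_def
      by (intro vector_derivative_works[THEN iffD1]) auto
    then have "(fst \<gamma> has_vector_derivative ?w t) (at t within {a..b})"
      using sub by (rule has_vector_derivative_within_subset)
    then show ?thesis using g1 that ab(2)
      by (intro vector_derivative_unique_within_closed_interval[of a b t]) auto
  qed
  have w_der: "(?w has_vector_derivative g2 t) (at t within {a..b})" if "t \<in> {a..b}" for t
    by (rule has_vector_derivative_transform[OF that w_g1 g2(1)[rule_format, OF that]])
  have "norm (g2 t) \<le> 1" if "t \<in> {a<..<b}" for t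
  proof -
    have "(?w has_vector_derivative g2 t) (at t)"
      using w_der[of t] that at_within_Icc_at[of a t b] by simp
    then have "(?w has_vector_derivative g2 t) (at t within {0..snd \<gamma>})"
      by (rule has_vector_derivative_at_within)
    moreover have "t \<in> {0..snd \<gamma>}" using that sub by auto
    ultimately show ?thesis using curv by blast
  qed
  then have g2_le: "norm (g2 t) \<le> 1" if "t \<in> {a..b}" for t
    using continuous_on_closure_norm_le[of "{a<..<b}" g2 1 t] g2(2) ab(2) that by auto
  have v_der: "((\<lambda>t. to_complex (?w t)) has_vector_derivative to_complex (g2 t)) (at t within {a..b})"
    if "t \<in> {a..b}" for t
    using bounded_linear.has_vector_derivative[OF bounded_linear_to_complex w_der[OF that]] .
  have "1-lipschitz_on {a..b} (\<lambda>t. to_complex (?w t))"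
  proof (rule bounded_derivative_imp_lipschitz)
    fix t assume t: "t \<in> {a..b}"
    show "((\<lambda>t. to_complex (?w t)) has_derivative (\<lambda>h. h *\<^sub>R to_complex (g2 t))) (at t within {a..b})"
      using v_der[OF t] unfolding has_vector_derivative_def .
    show "onorm (\<lambda>h. h *\<^sub>R to_complex (g2 t)) \<le> 1"
    proof (rule onorm_bound)
      show "norm (h *\<^sub>R to_complex (g2 t)) \<le> 1 * norm h" for h :: real
        using mult_left_mono[OF g2_le[OF t], of "\<bar>h\<bar>"] by simp
    qed simp
  qed auto
  moreover have "C1_on (\<lambda>t. to_complex (?w t)) a b"
    unfolding C1_on_def
    by (intro exI[of _ "\<lambda>t. to_complex (g2 t)"] conjI ballI v_der
        bounded_linear.continuous_on[OF bounded_linear_to_complex g2(2)])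
  ultimately show ?thesis
    using unit sub ab(2) unfolding steering_def by (simp add: pw_C1_single subset_iff)
qed

lemma path_steering:
  assumes "\<gamma> \<in> bounded_curvature_paths x y"
  defines "v \<equiv> \<lambda>t. to_complex (velocity \<gamma> t)"
  shows "steering v 0 (snd \<gamma>)"
    and "\<And>t. t \<in> {0..snd \<gamma>} \<Longrightarrow> to_complex (fst \<gamma> t) = to_complex (fst x) + integral {0..t} v"
proof -
  have s: "0 < snd \<gamma>" and C1: "C1_path \<gamma>" and pw: "piecewise_C2_path \<gamma>"
    and unit: "\<forall>t\<in>{0..snd \<gamma>}. norm (velocity \<gamma> t) = 1" and start: "fst \<gamma> 0 = fst x"
    and curv: "\<forall>t\<in>{0..snd \<gamma>}. \<forall>A. (velocity \<gamma> has_vector_derivative A) (at t within {0..snd \<gamma>}) \<longrightarrow> norm A \<le> 1"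
    using assms(1) unfolding bounded_curvature_paths_def by auto
  obtain n p where p: "p 0 = 0" "p n = snd \<gamma>"
    "\<And>i. i < n \<Longrightarrow> p i < p (Suc i) \<and> C2_on_interval (fst \<gamma>) (p i) (p (Suc i))"
    using pw unfolding piecewise_C2_path_def by blast
  have mono: "p i \<le> p j" if "i \<le> j" "j \<le> n" for i j
    using that
  proof (induction j rule: dec_induct)
    case (step j) then show ?case using p(3)[of j] by simp
  qed simp
  have "steering v 0 (p i)" if "i \<le> n" for i
    using that
  proof (induction i)
    case 0
    then show ?case using s unit by (simp add: p(1) v_def steering_def pw_C1.refl lipschitz_on_def)
  next
    case (Suc i)
    have "0 \<le> p i" "p (Suc i) \<le> snd \<gamma>" using mono[of 0 i] mono[of "Suc i" n] p(1,2) Suc.prems by auto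
    then have "steering v (p i) (p (Suc i))"
      unfolding v_def using p(3)[of i] Suc.prems C1 unit curv by (intro steering_on_piece) auto
    then show ?case using Suc steering_join by auto
  qed
  from this[of n] show st: "steering v 0 (snd \<gamma>)" using p(2) by simp
  fix t assume t: "t \<in> {0..snd \<gamma>}"
  have "((\<lambda>t. to_complex (fst \<gamma> t)) has_vector_derivative v u) (at u within {0..t})" if "u \<in> {0..t}" for u
  proof -
    have "(fst \<gamma> has_vector_derivative velocity \<gamma> u) (at u within {0..snd \<gamma>})"
      using C1 t that unfolding C1_path_def velocity_def
      by (intro vector_derivative_works[THEN iffD1]) auto
    then have "(fst \<gamma> has_vector_derivative velocity \<gamma> u) (at u within {0..t})"
      by (rule has_vector_derivative_within_subset) (use t in auto)
    then show ?thesis unfolding v_def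
      by (rule bounded_linear.has_vector_derivative[OF bounded_linear_to_complex])
  qed
  then have "(v has_integral to_complex (fst \<gamma> t) - to_complex (fst \<gamma> 0)) {0..t}"
    using t by (intro fundamental_theorem_of_calculus) auto
  then show "to_complex (fst \<gamma> t) = to_complex (fst x) + integral {0..t} v"
    using start by (simp add: integral_unique)
qed

lemma pw_C1_breakpoints:
  assumes "pw_C1 v a b"
  shows "\<exists>(n::nat) p. p 0 = a \<and> p n = b \<and> (\<forall>i<n. p i < p (Suc i) \<and> C1_on v (p i) (p (Suc i)))"
  using assms
proof (induction rule: pw_C1.induct)
  case (refl a)
  show ?case by (intro exI[of _ 0] exI[of _ "\<lambda>_. a"]) simp
next
  case (step a b c)
  then obtain n p where p: "p 0 = b" "p n = c" "\<forall>i<n. p i < p (Suc i) \<and> C1_on v (p i) (p (Suc i))"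
    by blast
  let ?q = "case_nat a p"
  have "?q i < ?q (Suc i) \<and> C1_on v (?q i) (?q (Suc i))" if "i < Suc n" for i
    using that p step(1,2) by (cases i) auto
  then show ?case using p by (intro exI[of _ "Suc n"] exI[of _ ?q]) auto
qed

text \<open>This recovers the curvature condition from the Lipschitz condition, also at those break points
  where the velocity happens to be differentiable.\<close>

lemma norm_vector_derivative_le:
  fixes f :: "real \<Rightarrow> 'a :: real_normed_vector"
  assumes lip: "1-lipschitz_on {a..b} f" and t: "t \<in> {a..b}" and "a < b"
    and A: "(f has_vector_derivative A) (at t within {a..b})"
  shows "norm A \<le> 1"
proof -
  let ?Q = "\<lambda>u. (1 / norm (u - t)) *\<^sub>R (f u - (f t + (u - t) *\<^sub>R A))"
  have "(?Q \<longlongrightarrow> 0) (at t within {a..b})"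
    using A unfolding has_vector_derivative_def has_derivative_within by blast
  then have "((\<lambda>u. norm (?Q u)) \<longlongrightarrow> 0) (at t within {a..b})" by (rule tendsto_norm_zero)
  moreover have "\<forall>\<^sub>F u in at t within {a..b}. norm A - 1 \<le> norm (?Q u)"
    unfolding eventually_at_filter
  proof (intro always_eventually allI impI)
    fix u assume u: "u \<noteq> t" "u \<in> {a..b}"
    define N where "N = norm (f u - (f t + (u - t) *\<^sub>R A))"
    have "\<bar>u - t\<bar> * norm A \<le> norm (f u - f t) + norm (f u - (f t + (u - t) *\<^sub>R A))"
      using norm_triangle_ineq4[of "f u - f t" "f u - (f t + (u - t) *\<^sub>R A)"] by simp
    also have "norm (f u - f t) \<le> \<bar>u - t\<bar>"
      using lipschitz_onD[OF lip u(2) t] by (simp add: dist_norm)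
    finally have "\<bar>u - t\<bar> * norm A \<le> \<bar>u - t\<bar> + N" by (simp add: N_def)
    then have "(norm A - 1) * \<bar>u - t\<bar> \<le> N" by (simp add: algebra_simps)
    then have "norm A - 1 \<le> N / \<bar>u - t\<bar>"
      using u(1) by (subst pos_le_divide_eq) auto
    moreover have "norm (?Q u) = N / \<bar>u - t\<bar>" by (simp add: N_def)
    ultimately show "norm A - 1 \<le> norm (?Q u)" by (simp only:)
  qed
  moreover have "at t within {a..b} \<noteq> bot"
    using t \<open>a < b\<close> by (simp add: trivial_limit_within)
  ultimately have "norm A - 1 \<le> 0" by (rule tendsto_lowerbound)
  then show ?thesis by simp
qed

lemma steering_path:
  fixes p :: plane
  assumes st: "steering v 0 T" and T: "0 < T"
  defines "\<beta> \<equiv> (\<lambda>t. p + to_plane (integral {0..t} v), T)"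
  shows "\<beta> \<in> bounded_curvature_paths (p, to_plane (v 0)) (p + to_plane (integral {0..T} v), to_plane (v T))"
proof -
  have snd_\<beta>: "snd \<beta> = T" by (simp add: \<beta>_def)
  have cont: "continuous_on {0..T} v" using st by (rule steering_continuous)
  have der: "(fst \<beta> has_vector_derivative to_plane (v t)) (at t within {0..T})" if "t \<in> {0..T}" for t
  proof -
    have "((\<lambda>t. integral {0..t} v) has_vector_derivative v t) (at t within {0..T})"
      using cont that by (rule integral_has_vector_derivative)
    from bounded_linear.has_vector_derivative[OF bounded_linear_to_plane this]
    show ?thesis unfolding \<beta>_def by (auto intro!: derivative_eq_intros)
  qed
  have vel: "velocity \<beta> t = to_plane (v t)" if "t \<in> {0..T}" for t
    using velocity_eq[of \<beta> t] der[OF that] that T by (simp add: \<beta>_def)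
  have lip: "1-lipschitz_on {0..T} (velocity \<beta>)"
  proof (rule lipschitz_onI)
    fix t u assume tu: "t \<in> {0..T}" "u \<in> {0..T}"
    have "dist (velocity \<beta> t) (velocity \<beta> u) = dist (v t) (v u)"
      unfolding dist_norm vel[OF tu(1)] vel[OF tu(2)] by (simp flip: to_plane_diff)
    then show "dist (velocity \<beta> t) (velocity \<beta> u) \<le> 1 * dist t u"
      using st lipschitz_onD[of 1 "{0..T}" v t u] tu unfolding steering_def by simp
  qed simp
  have "C1_path \<beta>"
    unfolding C1_path_def snd_\<beta>
    using differentiableI_vector[OF der] lipschitz_on_continuous_on[OF lip] by blast
  moreover have "piecewise_C2_path \<beta>"
  proof -
    obtain n q where q: "q 0 = 0" "q (n::nat) = T" "\<And>i. i < n \<Longrightarrow> q i < q (Suc i) \<and> C1_on v (q i) (q (Suc i))"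
      using st pw_C1_breakpoints[of v 0 T] unfolding steering_def by blast
    have mono: "q i \<le> q j" if "i \<le> j" "j \<le> n" for i j
      using that
    proof (induction j rule: dec_induct)
      case (step j) then show ?case using q(3)[of j] by simp
    qed simp
    have "C2_on_interval (fst \<beta>) (q i) (q (Suc i))" if i: "i < n" for i
    proof -
      have sub: "{q i..q (Suc i)} \<subseteq> {0..T}" using mono[of 0 i] mono[of "Suc i" n] q(1,2) that by auto
      obtain v' where v': "\<forall>t\<in>{q i..q (Suc i)}. (v has_vector_derivative v' t) (at t within {q i..q (Suc i)})"
        "continuous_on {q i..q (Suc i)} v'"
        using q(3)[OF i] unfolding C1_on_def by blast
      show ?thesis unfolding C2_on_interval_def
      proof (rule exI[of _ "\<lambda>t. to_plane (v t)"], rule exI[of _ "\<lambda>t. to_plane (v' t)"], intro conjI ballI)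
        fix t assume t: "t \<in> {q i..q (Suc i)}"
        show "(fst \<beta> has_vector_derivative to_plane (v t)) (at t within {q i..q (Suc i)})"
          using has_vector_derivative_within_subset[OF der[of t] sub] t sub by auto
        show "((\<lambda>t. to_plane (v t)) has_vector_derivative to_plane (v' t)) (at t within {q i..q (Suc i)})"
          by (rule bounded_linear.has_vector_derivative[OF bounded_linear_to_plane v'(1)[rule_format, OF t]])
      next
        show "continuous_on {q i..q (Suc i)} (\<lambda>t. to_plane (v' t))"
          by (rule bounded_linear.continuous_on[OF bounded_linear_to_plane v'(2)])
      qed
    qed
    then show ?thesis unfolding piecewise_C2_path_def snd_\<beta>
      using q by (intro exI[of _ n] exI[of _ q]) blast
  qed
  moreover have "norm (velocity \<beta> t) = 1" if "t \<in> {0..T}" for t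
    using st that vel[OF that] unfolding steering_def by auto
  moreover have "norm A \<le> 1"
    if "t \<in> {0..T}" "(velocity \<beta> has_vector_derivative A) (at t within {0..T})" for t A
    using norm_vector_derivative_le[OF lip that(1) T that(2)] .
  moreover have "fst \<beta> 0 = p" "fst \<beta> T = p + to_plane (integral {0..T} v)"
    by (simp_all add: \<beta>_def to_plane_def vec_eq_iff forall_2)
  ultimately show ?thesis
    using T vel[of 0] vel[of T] unfolding bounded_curvature_paths_def by (auto simp: \<beta>_def)
qed

lemma integral_along_from:
  assumes "along v k a b" "k \<in> {-1, 0, 1}" "a \<le> t" "t \<le> b"
  shows "integral {a..t} v = v a * turn_disp k (t - a)"
  by (rule integral_along[OF along_subinterval[OF assms(1) order_refl assms(4)] assms(3,2)])

definition component_of :: "real \<Rightarrow> component" where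
  "component_of k = (if k = 0 then St else if k = 1 then Lt else Rt)"

text \<open>The centre of the circle lies at distance \<open>1\<close> from the path, to the left for a left turn and to the right
  for a right turn.\<close>

lemma traverses_if_along:
  assumes pos: "\<And>t. t \<in> {a..b} \<Longrightarrow> to_complex (g t) = to_complex (g a) + integral {a..t} v"
    and al: "along v k a b" and ab: "a \<le> b" and k: "k \<in> {-1, 0, 1}"
    and short: "k \<noteq> 0 \<Longrightarrow> b - a \<le> 2 * pi" and unit: "norm (v a) = 1"
  shows "traverses g (component_of k) a b"
proof -
  have g: "to_complex (g t) = to_complex (g a) + v a * turn_disp k (t - a)" if "t \<in> {a..b}" for t
    using pos[OF that] integral_along_from[OF al k, of t] that by auto
  define \<alpha> where "\<alpha> = Arg (v a)"
  have va: "v a = cis \<alpha>" using rcis_cmod_Arg[of "v a"] unit by (simp add: \<alpha>_def rcis_def)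
  consider "k = 0" | "k = 1" | "k = -1" using k by auto
  then show ?thesis
  proof cases
    case 1
    have "g t = g a + (t - a) *\<^sub>R to_plane (v a)" if "t \<in> {a..b}" for t
    proof -
      have "v a * turn_disp 0 (t - a) = (t - a) *\<^sub>R v a"
        by (simp only: turn_disp_straight scaleR_conv_of_real mult.commute)
      then have "to_plane (to_complex (g t)) = to_plane (to_complex (g a) + (t - a) *\<^sub>R v a)"
        using g[OF that] unfolding 1 by (simp only:)
      then show ?thesis
        by (simp add: to_plane_add to_plane_scaleR)
    qed
    moreover have "norm (to_plane (v a)) = 1" using unit by simp
    ultimately have "\<exists>p w. norm w = 1 \<and> (\<forall>t\<in>{a..b}. g t = p + (t - a) *\<^sub>R w)" by blast
    then show ?thesis using 1 ab by (simp add: component_of_def)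
  next
    case 2
    have "g t = circle_point (to_plane (to_complex (g a) + \<i> * cis \<alpha>)) (\<alpha> - pi / 2 + (t - a))" if "t \<in> {a..b}" for t
    proof (rule to_complex_inject)
      have "cis (\<alpha> - pi / 2 + (t - a)) = - \<i> * cis \<alpha> * cis (t - a)"
        by (simp add: complex_eq_iff cos_add sin_add cos_diff sin_diff)
      then show "to_complex (g t) = to_complex (circle_point (to_plane (to_complex (g a) + \<i> * cis \<alpha>)) (\<alpha> - pi / 2 + (t - a)))"
        unfolding g[OF that] circle_point_to_complex 2 turn_disp_left va by (simp add: algebra_simps)
    qed
    then have "\<exists>c \<theta>. \<forall>t\<in>{a..b}. g t = circle_point c (\<theta> + (t - a))" by blast
    then show ?thesis using 2 ab short by (simp add: component_of_def)
  next
    case 3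
    have "g t = circle_point (to_plane (to_complex (g a) - \<i> * cis \<alpha>)) (\<alpha> + pi / 2 - (t - a))" if "t \<in> {a..b}" for t
    proof (rule to_complex_inject)
      have "cis (\<alpha> + pi / 2 - \<tau>) = \<i> * cis \<alpha> * cis (- \<tau>)" for \<tau>
        by (simp add: complex_eq_iff cos_add sin_add cos_diff sin_diff)
      note c = this[of "t - a"]
      show "to_complex (g t) = to_complex (circle_point (to_plane (to_complex (g a) - \<i> * cis \<alpha>)) (\<alpha> + pi / 2 - (t - a)))"
        unfolding g[OF that] circle_point_to_complex 3 turn_disp_right va c by (simp add: algebra_simps)
    qed
    then have "\<exists>c \<theta>. \<forall>t\<in>{a..b}. g t = circle_point c (\<theta> - (t - a))" by blast
    then show ?thesis using 3 ab short by (simp add: component_of_def)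
  qed
qed

section \<open>Length minimising paths\<close>

text \<open>Integrating a direction function with the same end data gives a path in the same class.\<close>

lemma minimal_path_shortest:
  assumes \<gamma>: "\<gamma> \<in> bounded_curvature_paths x y"
    and min: "\<forall>\<beta> \<in> bounded_curvature_paths x y. path_len \<gamma> \<le> path_len \<beta>"
    and ab: "0 \<le> a" "a \<le> b" "b \<le> snd \<gamma>"
  shows "shortest (\<lambda>t. to_complex (velocity \<gamma> t)) a b"
proof -
  let ?v = "\<lambda>t. to_complex (velocity \<gamma> t)" and ?s = "snd \<gamma>"
  have s: "0 < ?s" and ends: "velocity \<gamma> 0 = snd x" "velocity \<gamma> ?s = snd y" "fst \<gamma> ?s = fst y"
    using \<gamma> unfolding bounded_curvature_paths_def by auto
  have st: "steering ?v 0 ?s" using \<gamma> by (rule path_steering)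
  have fin: "to_complex (fst y) = to_complex (fst x) + integral {0..?s} ?v"
    using path_steering(2)[OF \<gamma>, of ?s] s ends by simp
  have y: "fst x + to_plane (integral {0..?s} ?v) = fst y"
    using arg_cong[OF fin, of to_plane] by (simp add: to_plane_add)
  show ?thesis
  proof (rule shortest_minimal[OF st _ ab])
    fix w T
    assume T: "0 < T" and w: "realises (?v 0) (?v ?s) (integral {0..?s} ?v) T w"
    have "((\<lambda>t. fst x + to_plane (integral {0..t} w)), T) \<in> bounded_curvature_paths x y"
      using steering_path[of w T "fst x"] w T y ends unfolding realises_def by simp
    then show "?s \<le> T" using min unfolding path_len_def by force
  qed
qed

text \<open>The hypothesis on the rates says that the word alternates wherever two arcs are adjacent.\<close>

lemma three_components_cs_path:
  assumes \<gamma>: "\<gamma> \<in> bounded_curvature_paths x y"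
    and cd: "0 \<le> c" "c \<le> d" "d \<le> snd \<gamma>"
    and k: "k1 \<in> {-1, 0, 1}" "k2 \<in> {-1, 0, 1}" "k3 \<in> {-1, 0, 1}"
    and al: "along (\<lambda>t. to_complex (velocity \<gamma> t)) k1 0 c" "along (\<lambda>t. to_complex (velocity \<gamma> t)) k2 c d"
      "along (\<lambda>t. to_complex (velocity \<gamma> t)) k3 d (snd \<gamma>)"
    and alt: "k2 = 0 \<or> k1 = - k2 \<and> k3 = - k2"
    and short: "k1 \<noteq> 0 \<Longrightarrow> c \<le> 2 * pi" "k2 \<noteq> 0 \<Longrightarrow> d - c \<le> 2 * pi" "k3 \<noteq> 0 \<Longrightarrow> snd \<gamma> - d \<le> 2 * pi"
  shows "cs_path x y \<gamma> [component_of k1, component_of k2, component_of k3] [0, c, d, snd \<gamma>]"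
proof -
  let ?v = "\<lambda>t. to_complex (velocity \<gamma> t)" and ?s = "snd \<gamma>"
  have st: "steering ?v 0 ?s" using \<gamma> by (rule path_steering)
  have trav: "traverses (fst \<gamma>) (component_of k) a b"
    if "0 \<le> a" "a \<le> b" "b \<le> ?s" "k \<in> {-1, 0, 1}" "along ?v k a b" "k \<noteq> 0 \<Longrightarrow> b - a \<le> 2 * pi" for k a b
  proof (rule traverses_if_along[OF _ that(5,2,4,6)])
    show "norm (?v a) = 1" using st that unfolding steering_def by auto
    fix t assume t: "t \<in> {a..b}"
    have "integral {0..a} ?v + integral {a..t} ?v = integral {0..t} ?v"
      using t that by (intro Henstock_Kurzweil_Integration.integral_combine steering_integrable
          steering_subinterval[OF st]) auto
    then show "to_complex (fst \<gamma> t) = to_complex (fst \<gamma> a) + integral {a..t} ?v"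
      using path_steering(2)[OF \<gamma>, of t] path_steering(2)[OF \<gamma>, of a] t that by simp
  qed
  have bounds: "d \<le> ?s" "c \<le> ?s" "0 \<le> d" "0 \<le> (0::real)" using cd by simp_all
  have "k1 \<noteq> 0 \<Longrightarrow> c - 0 \<le> 2 * pi" using short(1) by simp
  then have "traverses (fst \<gamma>) (component_of k1) 0 c"
    by (rule trav[OF bounds(4) cd(1) bounds(2) k(1) al(1)])
  moreover have "traverses (fst \<gamma>) (component_of k2) c d"
    by (rule trav[OF cd(1,2,3) k(2) al(2) short(2)])
  moreover have "traverses (fst \<gamma>) (component_of k3) d ?s"
    by (rule trav[OF bounds(3) cd(3) order_refl k(3) al(3) short(3)])
  moreover have "component_of k2 \<noteq> St \<Longrightarrow> component_of k1 \<noteq> component_of k2 \<and> component_of k2 \<noteq> component_of k3"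
    using alt k(2) by (auto simp: component_of_def)
  ultimately show ?thesis
    using \<gamma> unfolding cs_path_def by (simp add: All_less_Suc less_Suc_eq nth_Cons')
qed

theorem theorem3p9:
  fixes x y :: "plane \<times> plane" and \<gamma> :: plane_path
  assumes "x \<in> unit_tangent_bundle" and "y \<in> unit_tangent_bundle"
    and "\<gamma> \<in> bounded_curvature_paths x y"
    and "\<forall>\<beta> \<in> bounded_curvature_paths x y. path_len \<gamma> \<le> path_len \<beta>"
  shows "(\<exists>w T. w \<in> CCC_words \<and> cs_path x y \<gamma> w T \<and> component_length T 1 > pi) \<or>
         (\<exists>w T. w \<in> CSC_words \<and> cs_path x y \<gamma> w T)"
proof -
  let ?v = "\<lambda>t. to_complex (velocity \<gamma> t)" and ?s = "snd \<gamma>"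
  interpret shortest_direction ?v ?s
  proof
    show "0 < ?s" using assms(3) unfolding bounded_curvature_paths_def by auto
    show "shortest ?v a b" if "0 \<le> a" "a \<le> b" "b \<le> ?s" for a b
      using minimal_path_shortest[OF assms(3,4) that] .
  qed
  show ?thesis
  proof (cases rule: CSC_or_CCC)
    case (CSC k1 k3 c d)
    have "cs_path x y \<gamma> [component_of k1, component_of 0, component_of k3] [0, c, d, ?s]"
      using CSC arc_length[of k1 0 c] arc_length[of k3 d ?s]
      by (intro three_components_cs_path[OF assms(3)]) auto
    moreover have "[component_of k1, component_of 0, component_of k3] \<in> CSC_words"
      using CSC by (auto simp: component_of_def CSC_words_def)
    ultimately show ?thesis by blast
  next
    case (CCC k c d)
    have "cs_path x y \<gamma> [component_of k, component_of (- k), component_of k] [0, c, d, ?s]"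
      using CCC arc_length[of k 0 c] arc_length[of "- k" c d] arc_length[of k d ?s]
      by (intro three_components_cs_path[OF assms(3)]) auto
    moreover have "[component_of k, component_of (- k), component_of k] \<in> CCC_words"
      using CCC by (auto simp: component_of_def CCC_words_def)
    moreover have "component_length [0, c, d, ?s] 1 > pi"
      using CCC by (simp add: component_length_def)
    ultimately show ?thesis by blast
  qed
qed

end
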